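(* Let $(c_i)_{i=1}^s$ be distinct and let $\{u_i\}_{i=1}^s$ satisfy the collocation condition. If the collocation parameters satisfy $$\int_{0}^1 \xi^k\prod_{i=1}^s(\xi-c_i)\, d\xi = 0,\qquad k=0,1,$$ then the corresponding $s$-stage FEPTRKN method has step order $p=s+2$.
   Context: Setting: the scalar initial value problem $y''(t)=f(t,y(t))$, $y(t_0)=y_0$, $y'(t_0)=y_0'$, on $[t_0,t_0+T]$, where $f$ is continuous in $t$, Lipschitz in $y$, and (for order statements) $f$ and the exact solution $y$ are sufficiently smooth. Notation: $\bm{c}=(c_1,\dots,c_s)^T$, $\bm{e}=(1,\dots,1)^T\in\mathbb{R}^s$; for a scalar function $v$, $v(\bm{e}t+\bm{c}h)=(v(t+c_1h),\dots,v(t+c_sh))^T$; $f(\bm{e}t+\bm{c}h,\bm{Y})=(f(t+c_1h,Y_1),\dots,f(t+c_sh,Y_s))^T$; $t_{n+1}=t_n+h$. Collocation condition: a set of sufficiently smooth functions $\{u_1,\dots,u_s\}$ satisfies the collocation condition if for any given $t\in[t_0,t_0+T)$ the $s\times s$ matrix $\bm{F}(t,h)=\big(u_1''(\bm{e}t+\bm{c}h),\dots,u_s''(\bm{e}t+\bm{c}h)\big)$ (columns) is nonsingular for almost every $h\in[0,h_{\max}]$, for some constant $h_{\max}>0$. FEPTRKN method (functionally-fitted explicit pseudo two-step Runge-Kutta-Nyström method) with respect to $\{u_i\}_{i=1}^s$: the coefficients $\bm{A}(t,h)\in\mathbb{R}^{s\times s}$, $\bm{b}(t,h),\bm{d}(t,h)\in\mathbb{R}^s$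 are defined, when $\bm{F}(t,h)$ is nonsingular and $h>0$, by requiring for all $i=1,\dots,s$ $$u_i(t+h)=u_i(t)+hu_i'(t)+h^2\bm{b}^T(t,h)u_i''(\bm{e}t+\bm{c}h),$$ $$u_i'(t+h)=u_i'(t)+h\bm{d}^T(t,h)u_i''(\bm{e}t+\bm{c}h),$$ $$u_i(\bm{e}t+\bm{c}h+\bm{e}h)=\bm{e}u_i(t+h)+h\bm{c}u_i'(t+h)+h^2\bm{A}(t,h)u_i''(\bm{e}t+\bm{c}h).$$ One step of the method maps $(y_n,y_n',\bm{Y}_n)$ to $$y_{n+1}=y_n+hy_n'+h^2\bm{b}^T(t_n,h)f(\bm{e}t_n+\bm{c}h,\bm{Y}_n),\qquad y_{n+1}'=y_n'+h\bm{d}^T(t_n,h)f(\bm{e}t_n+\bm{c}h,\bm{Y}_n),$$ $$\bm{Y}_{n+1}=\bm{e}y_{n+1}+h\bm{c}y_{n+1}'+h^2\bm{A}(t_n,h)f(\bm{e}t_n+\bm{c}h,\bm{Y}_n).$$ Orders: the method has step order $p=\min\{p_1,p_2\}$ and stage order $r=\min\{p_1,p_2,p_3\}$ if $$y(t_{n+1})-y_{n+1}=O(h^{p_1+1}),\quad y'(t_{n+1})-y'_{n+1}=O(h^{p_2+1}),\quad y(\bm{e}t_{n+1}+\bm{c}h)-\bm{Y}_{n+1}=O(h^{p_3+1}),$$ given that $y_n=y(t_n)$, $y_n'=y'(t_n)$, and $y(\bm{e}t_n+\bm{c}h)-\bm{Y}_n=O(h^{p_3+1})$. The paper's convention is that the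 starting stage vector $\bm{Y}_0$ is accurate enough that $\bm{Y}_n-y(\bm{e}t_n+\bm{c}h)=O(h^{s+2})$ for all $n\ge 0$ (i.e. $p_3=s+1$). The symbols $O(\cdot)$ refer to $h\to0^+$ (through values for which $\bm{F}(t_n,h)$ is nonsingular) with $t_n$ fixed.
   Formalization: Step order s+2 is proved at each t_n where the Wronskian of u_1'',...,u_s'' is nonzero (the other t_n are shown to be nowhere dense); at its zeros the claim can fail, e.g. s=2, u_1''=1, u_2''=t^4, t_n=0, y''=t. *)

theory Defs
  imports "HOL-Analysis.Analysis" "HOL-Library.Landau_Symbols"
begin

text \<open>
  The stages are indexed by a finite type \<open>'s\<close>, so \<open>s\<close> is \<open>CARD('s)\<close> and is at least 1.
  Derivatives are iterates of \<^const>\<open>deriv\<close>; they are meaningful on the open set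
  \<open>D\<close> on which the functions are assumed to be smooth.
\<close>

definition Ck_on :: "nat \<Rightarrow> real set \<Rightarrow> (real \<Rightarrow> real) \<Rightarrow> bool" where
  "Ck_on k D g \<longleftrightarrow>
     (\<forall>j<k. \<forall>x\<in>D. (deriv ^^ j) g differentiable (at x)) \<and> continuous_on D ((deriv ^^ k) g)"

text \<open>
  The solution lives on an open \<open>D\<close> containing \<open>[t0, t0 + T]\<close>, because the nodes
  \<open>t + c\<^sub>i h\<close> may lie to the left of \<open>t0\<close> (the \<open>c\<^sub>i\<close> are not required to be in \<open>[0, 1]\<close>).
\<close>

definition solves_ivp ::
  "real set \<Rightarrow> (real \<Rightarrow> real \<Rightarrow> real) \<Rightarrow> real \<Rightarrow> real \<Rightarrow> real \<Rightarrow> (real \<Rightarrow> real) \<Rightarrow> bool" where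
  "solves_ivp D f t0 y0 y0' y \<longleftrightarrow>
     y t0 = y0 \<and> deriv y t0 = y0' \<and> (\<forall>t\<in>D. (deriv ^^ 2) y t = f t (y t))"

definition at_nodes :: "real ^ 's \<Rightarrow> real \<Rightarrow> real \<Rightarrow> (real \<Rightarrow> real) \<Rightarrow> real ^ 's" where
  "at_nodes c t h v = (\<chi> i. v (t + c $ i * h))"

definition f_at_nodes ::
  "real ^ 's \<Rightarrow> real \<Rightarrow> real \<Rightarrow> (real \<Rightarrow> real \<Rightarrow> real) \<Rightarrow> real ^ 's \<Rightarrow> real ^ 's" where
  "f_at_nodes c t h f Y = (\<chi> i. f (t + c $ i * h) (Y $ i))"

definition F_matrix ::
  "('s \<Rightarrow> real \<Rightarrow> real) \<Rightarrow> real ^ 's \<Rightarrow> real \<Rightarrow> real \<Rightarrow> real ^ 's ^ 's" where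
  "F_matrix u c t h = (\<chi> i j. at_nodes c t h ((deriv ^^ 2) (u j)) $ i)"

definition collocation_condition ::
  "('s::finite \<Rightarrow> real \<Rightarrow> real) \<Rightarrow> real ^ 's \<Rightarrow> real \<Rightarrow> real \<Rightarrow> bool" where
  "collocation_condition u c t0 T \<longleftrightarrow>
     (\<exists>hmax>0. \<forall>t\<in>{t0..<t0 + T}. AE h in lebesgue_on {0..hmax}. invertible (F_matrix u c t h))"

definition fitted ::
  "('s::finite \<Rightarrow> real \<Rightarrow> real) \<Rightarrow> real ^ 's \<Rightarrow> real \<Rightarrow> real \<Rightarrow>
     real ^ 's ^ 's \<Rightarrow> real ^ 's \<Rightarrow> real ^ 's \<Rightarrow> bool" where
  "fitted u c t h A b d \<longleftrightarrow>
     (\<forall>i. let g = at_nodes c t h ((deriv ^^ 2) (u i)) in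
        u i (t + h) = u i t + h * deriv (u i) t + h\<^sup>2 * (b \<bullet> g) \<and>
        deriv (u i) (t + h) = deriv (u i) t + h * (d \<bullet> g) \<and>
        at_nodes c (t + h) h (u i) =
          vec (u i (t + h)) + (h * deriv (u i) (t + h)) *\<^sub>R c + h\<^sup>2 *\<^sub>R (A *v g))"

text \<open>The method state is the triple \<open>(y\<^sub>n, y\<^sub>n', Y\<^sub>n)\<close>.\<close>

definition feptrkn_step ::
  "real ^ 's \<Rightarrow> real ^ 's ^ 's \<Rightarrow> real ^ 's \<Rightarrow> real ^ 's \<Rightarrow> (real \<Rightarrow> real \<Rightarrow> real) \<Rightarrow> real \<Rightarrow> real \<Rightarrow>
     real \<times> real \<times> (real ^ 's) \<Rightarrow> real \<times> real \<times> (real ^ 's)" where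
  "feptrkn_step c A b d f t h = (\<lambda>(yn, yn', Yn).
     let fn = f_at_nodes c t h f Yn;
         z = yn + h * yn' + h\<^sup>2 * (b \<bullet> fn);
         z' = yn' + h * (d \<bullet> fn)
     in (z, z', vec z + (h * z') *\<^sub>R c + h\<^sup>2 *\<^sub>R (A *v fn)))"

definition step_filter ::
  "('s::finite \<Rightarrow> real \<Rightarrow> real) \<Rightarrow> real ^ 's \<Rightarrow> real \<Rightarrow> real filter" where
  "step_filter u c t = at 0 within {h. 0 < h \<and> invertible (F_matrix u c t h)}"

text \<open>
  In \<open>has_orders\<close> the old stage vector is an arbitrary function \<open>Y\<close> of the step size \<open>h\<close> that is
  accurate to \<open>O(h^(p3 + 1))\<close>.
\<close>

definition has_orders ::
  "('s::finite \<Rightarrow> real \<Rightarrow> real) \<Rightarrow> real ^ 's \<Rightarrow>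
     (real \<Rightarrow> real \<Rightarrow> real ^ 's ^ 's) \<Rightarrow> (real \<Rightarrow> real \<Rightarrow> real ^ 's) \<Rightarrow> (real \<Rightarrow> real \<Rightarrow> real ^ 's) \<Rightarrow>
     (real \<Rightarrow> real \<Rightarrow> real) \<Rightarrow> (real \<Rightarrow> real) \<Rightarrow> real \<Rightarrow> nat \<Rightarrow> nat \<Rightarrow> nat \<Rightarrow> bool" where
  "has_orders u c A b d f y t p1 p2 p3 \<longleftrightarrow>
     (\<forall>Y. (\<lambda>h. norm (at_nodes c t h y - Y h)) \<in> O[step_filter u c t](\<lambda>h. h ^ (p3 + 1)) \<longrightarrow>
        (let new = (\<lambda>h. feptrkn_step c (A t h) (b t h) (d t h) f t h (y t, deriv y t, Y h)) in
          (\<lambda>h. y (t + h) - fst (new h)) \<in> O[step_filter u c t](\<lambda>h. h ^ (p1 + 1)) \<and>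
          (\<lambda>h. deriv y (t + h) - fst (snd (new h))) \<in> O[step_filter u c t](\<lambda>h. h ^ (p2 + 1)) \<and>
          (\<lambda>h. norm (at_nodes c (t + h) h y - snd (snd (new h))))
            \<in> O[step_filter u c t](\<lambda>h. h ^ (p3 + 1))))"

text \<open>
  The stage vectors are by convention accurate to \<open>O(h^(s + 2))\<close>, that is, \<open>p3 = s + 1\<close>.
\<close>

definition has_step_order ::
  "('s::finite \<Rightarrow> real \<Rightarrow> real) \<Rightarrow> real ^ 's \<Rightarrow>
     (real \<Rightarrow> real \<Rightarrow> real ^ 's ^ 's) \<Rightarrow> (real \<Rightarrow> real \<Rightarrow> real ^ 's) \<Rightarrow> (real \<Rightarrow> real \<Rightarrow> real ^ 's) \<Rightarrow>
     (real \<Rightarrow> real \<Rightarrow> real) \<Rightarrow> (real \<Rightarrow> real) \<Rightarrow> real \<Rightarrow> nat \<Rightarrow> bool" where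
  "has_step_order u c A b d f y t p \<longleftrightarrow>
     (\<exists>p1 p2. p = min p1 p2 \<and> has_orders u c A b d f y t p1 p2 (CARD('s) + 1))"

text \<open>
  \<open>wronskian_nonzero u t\<close> says that the Wronskian of \<open>{u\<^sub>j''}\<close> does not vanish at \<open>t\<close>. The
  derivatives of order \<open>0, \<dots>, s - 1\<close> are assigned to the rows by an enumeration \<open>e\<close> of the
  index type; changing \<open>e\<close> only changes the sign of the determinant.

  The collocation condition permits isolated (and even nowhere dense) zeros of the Wronskian, and
  at such points the step order can drop: for \<open>s = 2\<close>, the Gauss nodes \<open>1/2 \<plusminus> sqrt 3 / 6\<close>,
  \<open>u\<^sub>1'' = 1\<close> and \<open>u\<^sub>2'' = t ^ 4\<close>, the problem \<open>y'' = t\<close>, \<open>y(0) = y'(0) = 0\<close> has the error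
  \<open>y'(h) - y\<^sub>1' = - h\<^sup>2 / 120\<close> after one step from \<open>0\<close> with exact stage values.
\<close>

definition wronskian_nonzero :: "('s::finite \<Rightarrow> real \<Rightarrow> real) \<Rightarrow> real \<Rightarrow> bool" where
  "wronskian_nonzero u t \<longleftrightarrow>
     (\<exists>e. bij_betw e (UNIV :: 's set) {..<CARD('s)} \<and>
        det ((\<chi> k j. (deriv ^^ (e k)) ((deriv ^^ 2) (u j)) t) :: real ^ 's ^ 's) \<noteq> 0)"

end

theory Submission
  imports Defs "HOL-Computational_Algebra.Polynomial"
begin

text \<open>
  Multiplied by the inverse Vandermonde matrix of the nodes, with its rows rescaled by \<open>k! / h^k\<close>,
  \<open>F(t, h)\<close> tends to the Wronskian matrix of the \<open>u\<^sub>j''\<close> as \<open>h\<close> tends to 0. Where the latter is invertible, \<open>F(t, h)\<^sup>-\<^sup>1\<close> maps the nodal values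
  of a smooth function to a bounded vector. Classical interpolatory weights \<open>w\<close>, which by the
  orthogonality conditions integrate two (for \<open>d\<close>) or one (for \<open>b\<close>) extra powers exactly, satisfy
  the fitting equations up to \<open>O(h^(n + q))\<close>; hence \<open>F\<^sup>T (\<omega> - w) = O(h^n)\<close> for the fitted
  weights \<open>\<omega>\<close>, and \<open>(\<omega> - w) \<bullet> y'' = (F\<^sup>T (\<omega> - w)) \<bullet> (F\<^sup>-\<^sup>1 y'')\<close> is of the same order.

  If the Wronskian vanished on an interval, then the \<open>u\<^sub>j''\<close> would be linearly dependent on a
  subinterval, so \<open>F(t, h)\<close> would be singular there for all small \<open>h\<close>.
\<close>

section \<open>Taylor expansions and linear algebra at the nodes\<close>

lemma Ck_on_deriv:
  assumes "Ck_on n D v" and "j + m \<le> n"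
  shows "Ck_on m D ((deriv ^^ j) v)"
proof -
  have eq: "(deriv ^^ i) ((deriv ^^ j) v) = (deriv ^^ (i + j)) v" for i
    by (simp add: funpow_add)
  have "continuous_on D ((deriv ^^ (m + j)) v)"
  \<comment> \<open>\<open>Ck_on\<close> records continuity only for the top derivative; the lower
    ones are continuous because they are differentiable.\<close>
  proof (cases "m + j = n")
    case True
    then show ?thesis using assms by (simp add: Ck_on_def)
  next
    case False
    then have "m + j < n" using assms by simp
    then show ?thesis using assms
      by (intro continuous_at_imp_continuous_on ballI differentiable_imp_continuous_within)
         (auto simp: Ck_on_def)
  qed
  then show ?thesis using assms unfolding Ck_on_def eq by auto
qed

text \<open>The Lagrange remainder is controlled by a bound of the \<open>n\<close>-th derivative on
  a compact ball. The filter \<open>nhds 0\<close> is two-sided, so increments of either sign are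
  covered.\<close>

lemma taylor_bigo:
  assumes "Ck_on n D v" and "open D" and "t \<in> D" and "n > 0"
  shows "(\<lambda>x. v (t + x) - (\<Sum>k<n. (deriv ^^ k) v t / fact k * x ^ k)) \<in> O[nhds 0](\<lambda>x. x ^ n)"
proof -
  obtain \<epsilon> where \<epsilon>: "\<epsilon> > 0" "cball t \<epsilon> \<subseteq> D"
    using assms open_contains_cball by blast
  have "bounded ((deriv ^^ n) v ` cball t \<epsilon>)"
    using assms \<epsilon> by (intro compact_imp_bounded compact_continuous_image)
      (auto simp: Ck_on_def intro: continuous_on_subset)
  then obtain K where K: "\<And>z. z \<in> cball t \<epsilon> \<Longrightarrow> \<bar>(deriv ^^ n) v z\<bar> \<le> K"
    unfolding bounded_iff by fastforce
  have bound: "\<bar>v (t + x) - (\<Sum>k<n. (deriv ^^ k) v t / fact k * x ^ k)\<bar> \<le> K / fact n * \<bar>x ^ n\<bar>"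
    if x: "\<bar>x\<bar> < \<epsilon>" for x
  \<comment> \<open>\<open>Taylor\<close> excludes the expansion point itself; there the sum reduces
    to \<open>v t\<close> because \<open>n > 0\<close>.\<close>
  proof (cases "x = 0")
    case True
    then show ?thesis using \<open>n > 0\<close> by (cases n) (auto simp: lessThan_Suc_eq_insert_0 sum.reindex)
  next
    case False
    have D: "DERIV ((deriv ^^ m) v) z :> (deriv ^^ Suc m) v z"
      if "m < n" "t - \<epsilon> \<le> z" "z \<le> t + \<epsilon>" for m z
    proof -
      have "z \<in> D" using that \<epsilon> by (auto simp: dist_real_def)
      then have "(deriv ^^ m) v differentiable (at z)" using assms that by (auto simp: Ck_on_def)
      then show ?thesis by (simp add: DERIV_deriv_iff_real_differentiable)
    qed
    have "\<exists>z. (if t + x < t then t + x < z \<and> z < t else t < z \<and> z < t + x) \<and>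
        v (t + x) = (\<Sum>m<n. (deriv ^^ m) v t / fact m * (t + x - t) ^ m) +
          (deriv ^^ n) v z / fact n * (t + x - t) ^ n"
      using x False D \<open>n > 0\<close>
      by (intro Taylor[where a = "t - \<epsilon>" and b = "t + \<epsilon>" and diff = "\<lambda>m. (deriv ^^ m) v"]) auto
    then obtain z where z: "if t + x < t then t + x < z \<and> z < t else t < z \<and> z < t + x"
      and eq: "v (t + x) = (\<Sum>m<n. (deriv ^^ m) v t / fact m * x ^ m) + (deriv ^^ n) v z / fact n * x ^ n"
      by auto
    have "z \<in> cball t \<epsilon>" using z x by (auto simp: dist_real_def split: if_splits)
    then show ?thesis using K eq
      by (simp add: abs_mult mult_right_mono divide_right_mono)
  qed
  have "eventually (\<lambda>x. \<bar>x\<bar> < \<epsilon>) (nhds 0)"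
    using \<epsilon> by (auto simp: eventually_nhds_metric dist_real_def)
  then show ?thesis
    by (intro bigoI[where c = "K / fact n"]) (auto elim!: eventually_mono dest: bound)
qed

lemma taylor_bigo_scaled:
  assumes "Ck_on n D v" and "open D" and "t \<in> D" and "n > 0" and F: "F \<le> nhds 0"
  shows "(\<lambda>h. v (t + a * h) - (\<Sum>k<n. (deriv ^^ k) v t / fact k * a ^ k * h ^ k)) \<in> O[F](\<lambda>h. h ^ n)"
proof -
  have lim: "filterlim (\<lambda>h. a * h) (nhds 0) F"
  proof -
    have "((\<lambda>h. a * h) \<longlongrightarrow> a * 0) (nhds 0)"
      by (intro tendsto_mult tendsto_const filterlim_ident)
    then show ?thesis using F by (auto intro: tendsto_mono)
  qed
  have "(\<lambda>h. v (t + a * h) - (\<Sum>k<n. (deriv ^^ k) v t / fact k * (a * h) ^ k)) \<in> O[F](\<lambda>h. (a * h) ^ n)"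
    using landau_o.big.compose[OF taylor_bigo[OF assms(1-4)] lim] .
  also have "(\<lambda>h. (a * h) ^ n) \<in> O[F](\<lambda>h. h ^ n)"
    by (simp add: power_mult_distrib)
  finally show ?thesis by (simp add: power_mult_distrib mult.assoc)
qed

text \<open>The factor \<open>a ^ (k + 1) / (k + 1)\<close> is the integral of x^k over [0, a].
  Indexing by the derivatives of \<open>(deriv ^^ 2) v\<close> makes the expansion comparable with a
  quadrature sum over that function.\<close>

lemma taylor_first_derivative:
  assumes "Ck_on (n + 2) D v" and "open D" and "t \<in> D" and "F \<le> nhds 0"
  shows "(\<lambda>h. deriv v (t + a * h) - deriv v t
           - h * (\<Sum>k<n. (deriv ^^ k) ((deriv ^^ 2) v) t / fact k * (a ^ (k + 1) / (k + 1)) * h ^ k))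
         \<in> O[F](\<lambda>h. h ^ (n + 1))"
proof -
  have "Ck_on (n + 1) D (deriv v)" using Ck_on_deriv[OF assms(1), of 1 "n + 1"] by simp
  from taylor_bigo_scaled[OF this assms(2,3) _ assms(4), of a]
  have *: "(\<lambda>h. deriv v (t + a * h) - (\<Sum>k<Suc n. (deriv ^^ k) (deriv v) t / fact k * a ^ k * h ^ k))
      \<in> O[F](\<lambda>h. h ^ (n + 1))" by simp
  have "(\<Sum>k<Suc n. (deriv ^^ k) (deriv v) t / fact k * a ^ k * h ^ k) = deriv v t +
    h * (\<Sum>k<n. (deriv ^^ k) ((deriv ^^ 2) v) t / fact k * (a ^ (k + 1) / (k + 1)) * h ^ k)" for h
    unfolding sum.lessThan_Suc_shift sum_distrib_left
    by (simp add: eval_nat_numeral funpow_swap1 field_simps)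
  then show ?thesis using * by (simp only: diff_diff_eq)
qed

text \<open>The factor in \<open>a\<close> is the integral of (a - x) x^k over [0, a], as it arises
  from integrating twice.\<close>

lemma taylor_second_derivative:
  assumes "Ck_on (n + 2) D v" and "open D" and "t \<in> D" and "F \<le> nhds 0"
  shows "(\<lambda>h. v (t + a * h) - v t - a * h * deriv v t
           - h\<^sup>2 * (\<Sum>k<n. (deriv ^^ k) ((deriv ^^ 2) v) t / fact k * (a ^ (k + 2) / ((k + 1) * (k + 2))) * h ^ k))
         \<in> O[F](\<lambda>h. h ^ (n + 2))"
proof -
  from taylor_bigo_scaled[OF assms(1,2,3) _ assms(4), of a]
  have *: "(\<lambda>h. v (t + a * h) - (\<Sum>k<Suc (Suc n). (deriv ^^ k) v t / fact k * a ^ k * h ^ k))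
      \<in> O[F](\<lambda>h. h ^ (n + 2))" by simp
  have D: "2 + 3 * real x + real x * real x = (2 + real x) * (1 + real x)" for x
    by (simp add: algebra_simps)
  have "(\<Sum>k<Suc (Suc n). (deriv ^^ k) v t / fact k * a ^ k * h ^ k) = v t + a * h * deriv v t +
    h\<^sup>2 * (\<Sum>k<n. (deriv ^^ k) ((deriv ^^ 2) v) t / fact k * (a ^ (k + 2) / ((k + 1) * (k + 2))) * h ^ k)" for h
    unfolding sum.lessThan_Suc_shift sum_distrib_left
    by (simp add: eval_nat_numeral funpow_swap1 add.assoc[symmetric])
       (simp only: D, simp only: mult_ac)
  then show ?thesis using * by (simp only: diff_diff_eq add.assoc)
qed

section \<open>Perturbation of invertible matrices, Vandermonde matrices and moments\<close>

lemma matrix_bounded_below: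
  fixes G :: "'a \<Rightarrow> real ^ 'n ^ 'n"
  assumes lim: "(G \<longlongrightarrow> W) F" and "invertible W"
  shows "\<exists>K>0. \<forall>\<^sub>F h in F. \<forall>x. norm x \<le> K * norm (G h *v x)"
proof -
  obtain W' where W': "W' ** W = mat 1" using \<open>invertible W\<close> by (auto simp: invertible_def)
  obtain B where B: "B > 0" "\<And>x. norm (W' *v x) \<le> B * norm x"
    using linear_bounded_pos[of "(*v) W'"] by (auto simp: mult.commute)
  have entry: "((\<lambda>h. \<bar>(W - G h) $ i $ j\<bar>) \<longlongrightarrow> 0) F" for i j
  proof -
    have "((\<lambda>h. \<bar>W $ i $ j - G h $ i $ j\<bar>) \<longlongrightarrow> \<bar>W $ i $ j - W $ i $ j\<bar>) F"
      by (intro tendsto_intros lim)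
    then show ?thesis by simp
  qed
  define \<delta> where "\<delta> h = (\<Sum>i\<in>UNIV. \<Sum>j\<in>UNIV. \<bar>(W - G h) $ i $ j\<bar>)" for h
  have \<delta>: "(\<delta> \<longlongrightarrow> 0) F"
    unfolding \<delta>_def using tendsto_sum[OF tendsto_sum[OF entry]] by auto
  have ge: "norm ((W - G h) *v x) \<le> \<delta> h * norm x" for h x
  proof -
    have "norm ((W - G h) *v x) \<le> (\<Sum>i\<in>UNIV. \<bar>((W - G h) *v x) $ i\<bar>)" by (rule norm_le_l1_cart)
    also have "\<dots> \<le> (\<Sum>i\<in>UNIV. \<Sum>j\<in>UNIV. \<bar>(W - G h) $ i $ j\<bar> * norm x)"
      unfolding matrix_vector_mult_def
      by (auto intro!: sum_mono order.trans[OF sum_abs] mult_left_mono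
          simp: abs_mult component_le_norm_cart)
    finally show ?thesis by (simp add: \<delta>_def sum_distrib_right)
  qed
  \<comment> \<open>Since \<open>W = G h + (W - G h)\<close>, the bound \<open>B\<close> for the
    inverse of \<open>W\<close> passes to \<open>G h\<close> once the perturbation costs at most
    half of \<open>norm x\<close>; absorbing that half gives the constant
    \<open>2 * B\<close>.\<close>
  have "eventually (\<lambda>h. \<delta> h < 1 / (2 * B)) F"
    using order_tendstoD(2)[OF \<delta>] B by simp
  then have "\<forall>\<^sub>F h in F. \<forall>x. norm x \<le> (2 * B) * norm (G h *v x)"
  proof eventually_elim
    case (elim h)
    show ?case
    proof
      fix x
      have "norm x = norm (W' *v (W *v x))" by (simp add: matrix_vector_mul_assoc W')
      also have "\<dots> \<le> B * norm (G h *v x + (W - G h) *v x)"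
        using B(2)[of "W *v x"] by (simp add: matrix_vector_mult_diff_rdistrib)
      also have "\<dots> \<le> B * (norm (G h *v x) + \<delta> h * norm x)"
        using B(1) by (intro mult_left_mono order.trans[OF norm_triangle_ineq] add_mono ge) auto
      also have "\<dots> \<le> B * (norm (G h *v x) + 1 / (2 * B) * norm x)"
        using B(1) elim by (intro mult_left_mono add_mono mult_right_mono) auto
      also have "\<dots> = B * norm (G h *v x) + norm x / 2"
        using B(1) by (simp add: field_simps)
      finally show "norm x \<le> (2 * B) * norm (G h *v x)" by simp
    qed
  qed
  then show ?thesis using B(1) by (intro exI[of _ "2 * B"]) auto
qed

text \<open>A kernel vector lists the coefficients of a polynomial of degree below s with s distinct
  roots, hence is zero. The bijection \<open>e\<close> turns column indices into exponents.\<close>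

lemma vandermonde_invertible:
  fixes c :: "real ^ 's::finite"
  assumes "inj (\<lambda>i. c $ i)" and e: "bij_betw e (UNIV :: 's set) {..<CARD('s)}"
  shows "invertible (\<chi> i k. c $ i ^ e k :: real ^ 's ^ 's)"
proof -
  have "x = 0" if x: "(\<chi> i k. c $ i ^ e k) *v x = 0" for x :: "real ^ 's"
  proof -
    define p where "p = (\<Sum>k\<in>UNIV. monom (x $ k) (e k))"
    have "poly p (c $ i) = 0" for i
      using x by (simp add: p_def poly_sum poly_monom matrix_vector_mult_def vec_eq_iff mult.commute)
    then have sub: "range (\<lambda>i. c $ i) \<subseteq> {z. poly p z = 0}" by auto
    have e_less: "e k < CARD('s)" for k using e by (auto simp: bij_betw_def)
    have "p = 0"
    proof (rule ccontr)
      assume "p \<noteq> 0"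
      have "CARD('s) = card (range (\<lambda>i. c $ i))" using assms(1) by (simp add: card_image)
      also have "\<dots> \<le> card {z. poly p z = 0}"
        using \<open>p \<noteq> 0\<close> sub by (intro card_mono poly_roots_finite)
      also have "\<dots> \<le> degree p" by (rule card_poly_roots_bound[OF \<open>p \<noteq> 0\<close>])
      also have "degree p \<le> CARD('s) - 1"
        unfolding p_def
      proof (intro degree_sum_le)
        show "degree (monom (x $ k) (e k)) \<le> CARD('s) - 1" for k
          using e_less[of k] by (intro order.trans[OF degree_monom_le]) linarith
      qed auto
      finally show False using zero_less_card_finite[where ?'a = 's] by linarith
    qed
    have "x $ k = 0" for k
    proof -
      have "coeff p (e k) = (\<Sum>l\<in>UNIV. if l = k then x $ l else 0)"
        unfolding p_def coeff_sum using e
        by (intro sum.cong) (auto simp: bij_betw_def inj_on_def)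
      then show ?thesis using \<open>p = 0\<close> by simp
    qed
    then show "x = 0" by (simp add: vec_eq_iff)
  qed
  then show ?thesis
    by (simp add: invertible_left_inverse matrix_left_invertible_ker)
qed

text \<open>The discrete functional kills \<open>p\<close> because the nodes are roots, and
  \<open>\<mu>\<close> kills it by assumption. They agree on the lower powers and \<open>p\<close>
  is monic, so they agree on the top power. Each orthogonality relation thus yields one further
  moment.\<close>

lemma moment_of_monic:
  fixes w :: "real ^ 's::finite" and p :: "real poly"
  assumes "\<And>k. k < degree p \<Longrightarrow> (\<Sum>i\<in>UNIV. w $ i * c $ i ^ k) = \<mu> k"
    and "lead_coeff p = 1" and "\<And>i. poly p (c $ i) = 0"
    and "(\<Sum>k\<le>degree p. coeff p k * \<mu> k) = 0"
  shows "(\<Sum>i\<in>UNIV. w $ i * c $ i ^ degree p) = \<mu> (degree p)"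
proof -
  let ?m = "\<lambda>k. \<Sum>i\<in>UNIV. w $ i * c $ i ^ k"
  have "0 = (\<Sum>i\<in>UNIV. w $ i * poly p (c $ i))" by (simp add: assms(3))
  also have "\<dots> = (\<Sum>k\<le>degree p. coeff p k * ?m k)"
    by (simp add: poly_altdef sum_distrib_left mult_ac) (rule sum.swap)
  also have "\<dots> = (\<Sum>k<degree p. coeff p k * \<mu> k) + ?m (degree p)"
    using assms(1,2) by (simp add: lessThan_Suc_atMost[symmetric])
  finally show ?thesis using assms(2,4) by (simp add: lessThan_Suc_atMost[symmetric])
qed

lemma integral_poly_unit_interval:
  fixes p :: "real poly"
  shows "integral {0..1} (poly p) = (\<Sum>k\<le>degree p. coeff p k / (k + 1))"
proof -
  have "((\<lambda>x. x ^ k) has_integral (1 ^ (k + 1) / (k + 1) - 0 ^ (k + 1) / (k + 1))) {0..1::real}" for k :: nat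
    by (rule fundamental_theorem_of_calculus)
      (auto simp: has_real_derivative_iff_has_vector_derivative[symmetric] add.commute[of 1]
        intro!: derivative_eq_intros, cases k, auto simp: field_simps)
  then have "((\<lambda>x. \<Sum>k\<le>degree p. coeff p k * x ^ k) has_integral (\<Sum>k\<le>degree p. coeff p k * (1 / (k + 1)))) {0..1::real}"
    by (intro has_integral_sum has_integral_mult_right) auto
  then show ?thesis
    by (simp add: integral_unique poly_altdef[abs_def])
qed

section \<open>Fitted weights\<close>

lemma bigo_eventually_eq:
  assumes "eventually (\<lambda>x. f x = g x) F" and "f \<in> O[F](h)"
  shows "g \<in> O[F](h)"
  using landau_o.big.in_cong[OF assms(1)] assms(2) by (rule iffD1)

lemma bigo_norm_vec:
  fixes x :: "'a \<Rightarrow> real ^ 'n"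
  assumes "\<And>i. (\<lambda>h. x h $ i) \<in> O[F](g)"
  shows "(\<lambda>h. norm (x h)) \<in> O[F](g)"
proof -
  have "(\<lambda>h. \<Sum>i\<in>UNIV. \<bar>x h $ i\<bar>) \<in> O[F](g)"
    using assms by (intro big_sum_in_bigo) simp
  moreover have "(\<lambda>h. norm (x h)) \<in> O[F](\<lambda>h. \<Sum>i\<in>UNIV. \<bar>x h $ i\<bar>)"
    by (intro landau_o.big_mono always_eventually allI) (simp add: norm_le_l1_cart)
  ultimately show ?thesis by (rule landau_o.big_trans[rotated])
qed

lemma bigo_inner:
  fixes x y :: "'a \<Rightarrow> 'b::real_inner"
  assumes "(\<lambda>h. norm (x h)) \<in> O[F](f)" and "(\<lambda>h. norm (y h)) \<in> O[F](g)"
  shows "(\<lambda>h. x h \<bullet> y h) \<in> O[F](\<lambda>h. f h * g h)"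
proof -
  have "(\<lambda>h. x h \<bullet> y h) \<in> O[F](\<lambda>h. norm (x h) * norm (y h))"
    by (intro landau_o.big_mono always_eventually allI) (simp add: Cauchy_Schwarz_ineq2)
  then show ?thesis by (rule landau_o.big_trans[OF _ landau_o.big.mult[OF assms]])
qed

lemma at_right_power_bigo:
  assumes "F \<le> at_right (0::real)" and "m \<le> n"
  shows "(\<lambda>h. h ^ n) \<in> O[F](\<lambda>h. h ^ m)"
proof -
  have "eventually (\<lambda>h::real. 0 < h \<and> h < 1) (at_right 0)"
    using eventually_at_right_real[OF zero_less_one] by (auto elim: eventually_mono)
  then have "eventually (\<lambda>h. norm (h ^ n) \<le> norm (h ^ m)) (at_right (0::real))"
    by eventually_elim (use \<open>m \<le> n\<close> in \<open>auto intro: power_decreasing\<close>)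
  then show ?thesis using assms(1) by (intro landau_o.big_mono) (auto simp: le_filter_def)
qed

text \<open>Equal moments make the first \<open>n\<close> Taylor terms of the quadrature sum and of
  \<open>J\<close> cancel. \<open>J\<close> is left abstract and \<open>q\<close> counts the powers
  of \<open>h\<close> in front of the weights, so the lemma serves velocity (\<open>q = 1\<close>)
  as well as position and stages (\<open>q = 2\<close>).\<close>

lemma quadrature_error:
  fixes w c :: "real ^ 's::finite"
  assumes "Ck_on n D g" and "open D" and "t \<in> D" and "n > 0" and "F \<le> nhds 0"
    and moments: "\<And>k. k < n \<Longrightarrow> (\<Sum>i\<in>UNIV. w $ i * c $ i ^ k) = \<mu> k"
    and J: "(\<lambda>h. J h - h ^ q * (\<Sum>k<n. (deriv ^^ k) g t / fact k * \<mu> k * h ^ k)) \<in> O[F](\<lambda>h. h ^ (n + q))"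
  shows "(\<lambda>h. h ^ q * (w \<bullet> at_nodes c t h g) - J h) \<in> O[F](\<lambda>h. h ^ (n + q))"
proof -
  have "(\<lambda>h. \<Sum>i\<in>UNIV. w $ i * (g (t + c $ i * h) - (\<Sum>k<n. (deriv ^^ k) g t / fact k * c $ i ^ k * h ^ k)))
      \<in> O[F](\<lambda>h. h ^ n)"
    using taylor_bigo_scaled[OF assms(1-5)] by (intro big_sum_in_bigo) simp
  then have "(\<lambda>h. h ^ q * (\<Sum>i\<in>UNIV. w $ i * (g (t + c $ i * h)
        - (\<Sum>k<n. (deriv ^^ k) g t / fact k * c $ i ^ k * h ^ k)))) \<in> O[F](\<lambda>h. h ^ q * h ^ n)"
    by (intro landau_o.big.mult) auto
  from sum_in_bigo(2)[OF this[folded power_add, unfolded add.commute[of q]] J]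
  show ?thesis
  proof (rule back_subst[where P = "\<lambda>f. f \<in> O[F](\<lambda>h. h ^ (n + q))"])
    have "(\<Sum>i\<in>UNIV. w $ i * (\<Sum>k<n. (deriv ^^ k) g t / fact k * c $ i ^ k * h ^ k)) =
      (\<Sum>k<n. (deriv ^^ k) g t / fact k * \<mu> k * h ^ k)" for h
    proof -
      have "(\<Sum>i\<in>UNIV. w $ i * (\<Sum>k<n. (deriv ^^ k) g t / fact k * c $ i ^ k * h ^ k)) =
        (\<Sum>k<n. (deriv ^^ k) g t / fact k * (\<Sum>i\<in>UNIV. w $ i * c $ i ^ k) * h ^ k)"
        unfolding sum_distrib_left sum_distrib_right by (subst sum.swap) (simp add: mult_ac)
      then show ?thesis by (simp add: moments)
    qed
    then show "(\<lambda>h. h ^ q * (\<Sum>i\<in>UNIV. w $ i * (g (t + c $ i * h)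
          - (\<Sum>k<n. (deriv ^^ k) g t / fact k * c $ i ^ k * h ^ k)))
        - (J h - h ^ q * (\<Sum>k<n. (deriv ^^ k) g t / fact k * \<mu> k * h ^ k)))
      = (\<lambda>h. h ^ q * (w \<bullet> at_nodes c t h g) - J h)"
      by (simp add: inner_vec_def at_nodes_def right_diff_distrib sum_subtractf)
  qed
qed

text \<open>Up to O(h^s), the nodal values are the Vandermonde matrix applied to the Taylor terms of
  \<open>g\<close>. The left inverse \<open>U\<close> isolates each term, and rescaling turns it
  into the derivative.\<close>

lemma scaled_nodes_tendsto:
  fixes c :: "real ^ 's::finite"
  assumes "Ck_on (CARD('s)) D g" and "open D" and "t \<in> D" and F: "F \<le> at_right 0"
    and e: "bij_betw e (UNIV :: 's set) {..<CARD('s)}"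
    and U: "U ** (\<chi> i k. c $ i ^ e k) = mat 1"
  shows "((\<lambda>h. (\<chi> k i. fact (e k) / h ^ e k * U $ k $ i) *v at_nodes c t h g)
           \<longlongrightarrow> (\<chi> k. (deriv ^^ e k) g t)) F"
proof (rule vec_tendstoI)
  fix k
  have F0: "F \<le> nhds 0" using F by (metis at_within_def inf.boundedE)
  have nz: "eventually (\<lambda>h. h \<noteq> 0) F"
    using F by (auto simp: le_filter_def eventually_at_filter)
  have ek: "e k < CARD('s)" using e by (auto simp: bij_betw_def)
  define R where "R i h = g (t + c $ i * h)
      - (\<Sum>l<CARD('s). (deriv ^^ l) g t / fact l * c $ i ^ l * h ^ l)" for i h
  have "(\<lambda>h. \<Sum>i\<in>UNIV. U $ k $ i * R i h) \<in> O[F](\<lambda>h. h ^ CARD('s))"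
    using taylor_bigo_scaled[OF assms(1-3) _ F0] unfolding R_def by (intro big_sum_in_bigo) simp
  \<comment> \<open>As \<open>e k\<close> is below s, one power of \<open>h\<close> is left over, so
    the remainder still vanishes after division by \<open>h ^ e k\<close>.\<close>
  also have "(\<lambda>h. h ^ CARD('s)) \<in> O[F](\<lambda>h. h * h ^ e k)"
    using at_right_power_bigo[OF F, of "Suc (e k)" "CARD('s)"] ek by simp
  also have "(\<lambda>h. h * h ^ e k) \<in> o[F](\<lambda>h. 1 * h ^ e k)"
  proof (rule landau_o.small_big_mult)
    have "((\<lambda>h. h) \<longlongrightarrow> 0) F" using F0 by (simp add: filterlim_def)
    then show "(\<lambda>h. h) \<in> o[F](\<lambda>h. 1)" by (intro smalloI_tendsto) auto
  qed simp
  finally have "(\<lambda>h. \<Sum>i\<in>UNIV. U $ k $ i * R i h) \<in> o[F](\<lambda>h. h ^ e k)" by simp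
  from tendsto_add[OF tendsto_const[of "(deriv ^^ e k) g t"]
      tendsto_mult[OF tendsto_const[of "fact (e k)"] smalloD_tendsto[OF this]]]
  have "((\<lambda>h. (deriv ^^ e k) g t + fact (e k) * ((\<Sum>i\<in>UNIV. U $ k $ i * R i h) / h ^ e k))
      \<longlongrightarrow> (\<chi> k. (deriv ^^ e k) g t) $ k) F" by simp
  then show "((\<lambda>h. ((\<chi> k i. fact (e k) / h ^ e k * U $ k $ i) *v at_nodes c t h g) $ k)
      \<longlongrightarrow> (\<chi> k. (deriv ^^ e k) g t) $ k) F"
  proof (rule Lim_transform_eventually)
    show "eventually (\<lambda>h. (deriv ^^ e k) g t + fact (e k) * ((\<Sum>i\<in>UNIV. U $ k $ i * R i h) / h ^ e k) =
      ((\<chi> k i. fact (e k) / h ^ e k * U $ k $ i) *v at_nodes c t h g) $ k) F"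
      using nz
    proof eventually_elim
      case (elim h)
      \<comment> \<open>The rows of \<open>U\<close> are dual to the node powers, so row
        \<open>k\<close> picks out exactly the Taylor term of order \<open>e k\<close>.\<close>
      have dual: "(\<Sum>i\<in>UNIV. U $ k $ i * c $ i ^ e l) = (if l = k then 1 else 0)" for l
        using arg_cong[OF U, of "\<lambda>M. M $ k $ l"] by (auto simp: matrix_matrix_mult_def mat_def)
      have "(\<Sum>i\<in>UNIV. U $ k $ i * (\<Sum>l<CARD('s). (deriv ^^ l) g t / fact l * c $ i ^ l * h ^ l))
        = (\<Sum>l<CARD('s). (deriv ^^ l) g t / fact l * (\<Sum>i\<in>UNIV. U $ k $ i * c $ i ^ l) * h ^ l)"
        unfolding sum_distrib_left sum_distrib_right by (subst sum.swap) (simp add: mult_ac)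
      also have "\<dots> = (\<Sum>l\<in>UNIV. (deriv ^^ e l) g t / fact (e l)
          * (\<Sum>i\<in>UNIV. U $ k $ i * c $ i ^ e l) * h ^ e l)"
        by (rule sum.reindex_bij_betw[OF e, symmetric])
      also have "\<dots> = (\<Sum>l\<in>UNIV. if l = k then (deriv ^^ e l) g t / fact (e l) * h ^ e l else 0)"
        by (intro sum.cong refl) (simp add: dual)
      finally have main: "(\<Sum>i\<in>UNIV. U $ k $ i * (\<Sum>l<CARD('s). (deriv ^^ l) g t / fact l * c $ i ^ l * h ^ l))
        = (deriv ^^ e k) g t / fact (e k) * h ^ e k" by simp
      have "(\<Sum>i\<in>UNIV. U $ k $ i * R i h) =
          (\<Sum>i\<in>UNIV. U $ k $ i * g (t + c $ i * h)) - (deriv ^^ e k) g t / fact (e k) * h ^ e k"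
        unfolding main[symmetric] R_def by (simp add: right_diff_distrib sum_subtractf)
      moreover have "((\<chi> k i. fact (e k) / h ^ e k * U $ k $ i) *v at_nodes c t h g) $ k
        = fact (e k) / h ^ e k * (\<Sum>i\<in>UNIV. U $ k $ i * g (t + c $ i * h))"
        by (simp add: matrix_vector_mult_def at_nodes_def sum_distrib_left mult_ac)
      ultimately show ?case using elim by (simp add: field_simps)
    qed
  qed
qed

text \<open>The parameters \<open>q\<close>, \<open>n\<close> and \<open>J\<close> let one argument
  treat all three fitting equations. Boundedness of \<open>\<omega>\<close> is a separate conclusion
  because it controls the effect of inexact stage values. For \<open>\<omega> h - w\<close> itself
  only boundedness is shown: undoing the row scaling costs up to s - 1 powers of \<open>h\<close>,
  which \<open>n\<close> covers.\<close>

lemma fitted_weights: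
  fixes u :: "'s::finite \<Rightarrow> real \<Rightarrow> real" and c w :: "real ^ 's" and \<omega> :: "real \<Rightarrow> real ^ 's"
  assumes "open D" and "t \<in> D" and F: "F \<le> at_right 0"
    and c: "inj (\<lambda>i. c $ i)" and e: "bij_betw e (UNIV :: 's set) {..<CARD('s)}"
    and W: "invertible (\<chi> k j. (deriv ^^ e k) ((deriv ^^ 2) (u j)) t :: real ^ 's ^ 's)"
    and u: "\<And>i. Ck_on (CARD('s) + 2) D (u i)" and y: "Ck_on (CARD('s) + 2) D y"
    and inv: "eventually (\<lambda>h. invertible (F_matrix u c t h)) F"
    and fit: "\<And>i. eventually (\<lambda>h. h ^ q * (\<omega> h \<bullet> at_nodes c t h ((deriv ^^ 2) (u i))) = J (u i) h) F"
    and u_err: "\<And>i. (\<lambda>h. h ^ q * (w \<bullet> at_nodes c t h ((deriv ^^ 2) (u i))) - J (u i) h)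
                 \<in> O[F](\<lambda>h. h ^ (n + q))"
    and y_err: "(\<lambda>h. h ^ q * (w \<bullet> at_nodes c t h ((deriv ^^ 2) y)) - J y h) \<in> O[F](\<lambda>h. h ^ (n + q))"
    and n: "CARD('s) \<le> n"
  shows "(\<lambda>h. norm (\<omega> h)) \<in> O[F](\<lambda>_. 1)"
    and "(\<lambda>h. h ^ q * (\<omega> h \<bullet> at_nodes c t h ((deriv ^^ 2) y)) - J y h) \<in> O[F](\<lambda>h. h ^ (n + q))"
proof -
  have F0: "F \<le> nhds 0" using F by (metis at_within_def inf.boundedE)
  have nz: "eventually (\<lambda>h. h \<noteq> 0) F"
    using F by (auto simp: le_filter_def eventually_at_filter)
  have nz_power: "eventually (\<lambda>h. h ^ k \<noteq> 0) F" for k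
    using nz by eventually_elim simp
  have e_less: "e k < CARD('s)" for k using e by (auto simp: bij_betw_def)
  define V where "V = (\<chi> i k. c $ i ^ e k :: real ^ 's ^ 's)"
  obtain U where UV: "U ** V = mat 1" and VU: "V ** U = mat 1"
    using vandermonde_invertible[OF c e] by (auto simp: invertible_def V_def)
  \<comment> \<open>\<open>N h\<close> turns nodal values into approximate derivatives;
    \<open>N' h\<close> evaluates the Taylor polynomial with given derivatives at the nodes.\<close>
  define N where "N h = (\<chi> k i. fact (e k) / h ^ e k * U $ k $ i)" for h :: real
  define N' where "N' h = (\<chi> i k. c $ i ^ e k * h ^ e k / fact (e k) :: real ^ 's ^ 's)" for h :: real
  have N'N: "N' h ** N h = mat 1" if "h \<noteq> 0" for h
    unfolding VU[symmetric] using that by (simp add: N_def N'_def V_def matrix_matrix_mult_def)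
  define M where "M h = F_matrix u c t h" for h
  define G where "G h = N h ** M h" for h
  have lim: "((\<lambda>h. N h *v at_nodes c t h ((deriv ^^ 2) v)) \<longlongrightarrow> (\<chi> k. (deriv ^^ e k) ((deriv ^^ 2) v) t)) F"
    if "Ck_on (CARD('s) + 2) D v" for v
    unfolding N_def using assms(1-3) e UV Ck_on_deriv[OF that, of 2 "CARD('s)"]
    by (intro scaled_nodes_tendsto) (auto simp: V_def)
  have col: "G h $ k $ j = (N h *v at_nodes c t h ((deriv ^^ 2) (u j))) $ k" for h k j
    by (simp add: G_def M_def F_matrix_def matrix_matrix_mult_def matrix_vector_mult_def)
  have G: "(G \<longlongrightarrow> (\<chi> k j. (deriv ^^ e k) ((deriv ^^ 2) (u j)) t)) F"
    using tendsto_vec_nth[OF lim[OF u]] by (intro vec_tendstoI) (simp add: col)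
  then have GT: "((\<lambda>h. transpose (G h)) \<longlongrightarrow> transpose (\<chi> k j. (deriv ^^ e k) ((deriv ^^ 2) (u j)) t)) F"
    by (intro vec_tendstoI) (auto simp: transpose_def dest!: tendsto_vec_nth)
  obtain K1 where K1: "K1 > 0" "\<forall>\<^sub>F h in F. \<forall>x. norm x \<le> K1 * norm (G h *v x)"
    using matrix_bounded_below[OF G W] by auto
  \<comment> \<open>Two lower bounds are needed: \<open>G\<close> bounds the coordinates of y'', its
    transpose bounds the weights, which meet \<open>M\<close> transposed in the fitting
    equations.\<close>
  obtain K2 where K2: "K2 > 0" "\<forall>\<^sub>F h in F. \<forall>x. norm x \<le> K2 * norm (transpose (G h) *v x)"
    using matrix_bounded_below[OF GT] W by (auto simp: invertible_det_nz det_transpose)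

  \<comment> \<open>\<open>\<alpha> h\<close> holds the coordinates of the nodal values of y'' in
    the columns of \<open>M h\<close>. It stays bounded because \<open>G h *v \<alpha> h\<close>
    converges.\<close>
  define \<alpha> where "\<alpha> h = matrix_inv (M h) *v at_nodes c t h ((deriv ^^ 2) y)" for h
  have M\<alpha>: "eventually (\<lambda>h. M h *v \<alpha> h = at_nodes c t h ((deriv ^^ 2) y)) F"
    using inv
  proof eventually_elim
    case (elim h)
    then have "M h ** matrix_inv (M h) = mat 1"
      unfolding M_def invertible_def matrix_inv_def by (rule someI2_ex) blast
    then show ?case by (simp add: \<alpha>_def matrix_vector_mul_assoc)
  qed
  have \<alpha>: "(\<lambda>h. norm (\<alpha> h)) \<in> O[F](\<lambda>_. 1)"
  proof -
    let ?l = "norm (\<chi> k. (deriv ^^ e k) ((deriv ^^ 2) y) t)"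
    have "eventually (\<lambda>h. norm (N h *v at_nodes c t h ((deriv ^^ 2) y)) < ?l + 1) F"
      using order_tendstoD(2)[OF tendsto_norm[OF lim[OF y]]] by simp
    with K1(2) M\<alpha> have "eventually (\<lambda>h. norm (norm (\<alpha> h)) \<le> (K1 * (?l + 1)) * norm (1::real)) F"
    proof eventually_elim
      case (elim h)
      have "norm (\<alpha> h) \<le> K1 * norm (G h *v \<alpha> h)" using elim by blast
      also have "G h *v \<alpha> h = N h *v at_nodes c t h ((deriv ^^ 2) y)"
        using elim by (simp add: G_def matrix_vector_mul_assoc[symmetric])
      finally show ?case using elim K1(1)
        by (auto intro: order.trans mult_left_mono)
    qed
    then show ?thesis by (rule bigoI)
  qed

  define \<delta> where "\<delta> h = \<omega> h - w" for h
  define r where "r h = transpose (M h) *v \<delta> h" for h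
  have r_nth: "r h $ i = \<delta> h \<bullet> at_nodes c t h ((deriv ^^ 2) (u i))" for h i
    by (simp add: r_def M_def F_matrix_def transpose_def matrix_vector_mult_def inner_vec_def mult.commute)
  have r: "(\<lambda>h. norm (r h)) \<in> O[F](\<lambda>h. h ^ n)"
  proof (rule bigo_norm_vec)
    fix i
    \<comment> \<open>By the fitting equation, \<open>h ^ q * r h $ i\<close> is the negative of the
      quadrature error of \<open>w\<close> on \<open>u i\<close>.\<close>
    have "eventually (\<lambda>h. - (h ^ q * (w \<bullet> at_nodes c t h ((deriv ^^ 2) (u i))) - J (u i) h) = h ^ q * r h $ i) F"
      using fit[of i] by eventually_elim (simp add: r_nth \<delta>_def inner_diff_left right_diff_distrib)
    moreover have "(\<lambda>h. - (h ^ q * (w \<bullet> at_nodes c t h ((deriv ^^ 2) (u i))) - J (u i) h))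
        \<in> O[F](\<lambda>h. h ^ (n + q))"
      using u_err[of i] by (simp only: landau_o.big.uminus_in_iff)
    ultimately have "(\<lambda>h. h ^ q * r h $ i) \<in> O[F](\<lambda>h. h ^ (n + q))"
      by (rule bigo_eventually_eq)
    then have "(\<lambda>h. h ^ q * r h $ i / h ^ q) \<in> O[F](\<lambda>h. h ^ (n + q) / h ^ q)"
      by (rule landau_o.big.divide_right[OF nz_power])
    then have "(\<lambda>h. r h $ i) \<in> O[F](\<lambda>h. h ^ (n + q) / h ^ q)"
      by (rule bigo_eventually_eq[rotated]) (use nz in eventually_elim, simp)
    moreover have "eventually (\<lambda>h. h ^ (n + q) / h ^ q = h ^ n) F"
      using nz by eventually_elim (simp add: power_add)
    ultimately show "(\<lambda>h. r h $ i) \<in> O[F](\<lambda>h. h ^ n)"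
      by (simp only: landau_o.big.cong)
  qed

  \<comment> \<open>Writing \<open>\<delta> h\<close> as \<open>transpose (N h) *v z h\<close> turns
    \<open>r h\<close> into \<open>transpose (G h) *v z h\<close>, so \<open>z\<close> inherits the
    rate of \<open>r\<close>.\<close>
  define z where "z h = transpose (N' h) *v \<delta> h" for h
  have N_z: "transpose (N h) *v z h = \<delta> h" if "h \<noteq> 0" for h
    using N'N[OF that] by (simp add: z_def matrix_vector_mul_assoc matrix_transpose_mul[symmetric] transpose_mat
      del: transpose_matrix_vector)
  have z: "(\<lambda>h. norm (z h)) \<in> O[F](\<lambda>h. h ^ n)"
  proof -
    have "eventually (\<lambda>h. norm (norm (z h)) \<le> K2 * norm (norm (r h))) F"
      using K2(2) nz
    proof eventually_elim
      case (elim h)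
      have "transpose (G h) *v z h = r h"
        by (simp add: G_def matrix_transpose_mul matrix_vector_mul_assoc[symmetric] N_z[OF elim(2)] r_def
          del: transpose_matrix_vector)
      then show ?case using elim(1)[rule_format, of "z h"] by simp
    qed
    then have "(\<lambda>h. norm (z h)) \<in> O[F](\<lambda>h. norm (r h))" by (rule bigoI)
    then show ?thesis using r by (rule landau_o.big_trans)
  qed
  have "(\<lambda>h. \<delta> h $ i) \<in> O[F](\<lambda>_. 1)" for i
  proof -
    have "(\<lambda>h. \<Sum>k\<in>UNIV. fact (e k) * U $ k $ i * (z h $ k / h ^ e k)) \<in> O[F](\<lambda>_. 1)"
    proof (intro big_sum_in_bigo)
      fix k
      have "(\<lambda>h. z h $ k) \<in> O[F](\<lambda>h. norm (z h))"
        by (intro landau_o.big_mono always_eventually allI) (simp add: component_le_norm_cart)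
      also note z
      also have "(\<lambda>h. h ^ n) \<in> O[F](\<lambda>h. h ^ e k)"
        using e_less[of k] n by (intro at_right_power_bigo[OF F]) simp
      finally have "(\<lambda>h. z h $ k / h ^ e k) \<in> O[F](\<lambda>h. h ^ e k / h ^ e k)"
        by (rule landau_o.big.divide_right[OF nz_power])
      also have "(\<lambda>h. h ^ e k / h ^ e k) \<in> O[F](\<lambda>_. 1)"
        using nz by (intro landau_o.big_mono) (simp add: eventually_mono)
      finally have "(\<lambda>h. z h $ k / h ^ e k) \<in> O[F](\<lambda>_. 1)" .
      from landau_o.big.mult[OF landau_o.big_refl this, of "\<lambda>_. fact (e k) * U $ k $ i"]
      show "(\<lambda>h. fact (e k) * U $ k $ i * (z h $ k / h ^ e k)) \<in> O[F](\<lambda>_. 1)"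
        by (rule landau_o.big_trans) simp
    qed
    then show ?thesis
    proof (rule bigo_eventually_eq[rotated])
      show "eventually (\<lambda>h. (\<Sum>k\<in>UNIV. fact (e k) * U $ k $ i * (z h $ k / h ^ e k)) = \<delta> h $ i) F"
        using nz
      proof eventually_elim
        case (elim h)
        show ?case unfolding N_z[OF elim, symmetric]
          by (simp add: N_def transpose_def matrix_vector_mult_def mult_ac)
      qed
    qed
  qed
  then have "(\<lambda>h. norm (\<delta> h)) \<in> O[F](\<lambda>_. 1)" by (rule bigo_norm_vec)
  then have \<delta>: "(\<lambda>h. norm (\<delta> h) + norm w) \<in> O[F](\<lambda>_. 1)" by (intro sum_in_bigo) auto
  have "(\<lambda>h. norm (\<omega> h)) \<in> O[F](\<lambda>h. norm (\<delta> h) + norm w)"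
    using norm_triangle_ineq[of "\<delta> _" w]
    by (intro landau_o.big_mono always_eventually allI) (simp add: \<delta>_def)
  then show "(\<lambda>h. norm (\<omega> h)) \<in> O[F](\<lambda>_. 1)" using \<delta> by (rule landau_o.big_trans)

  \<comment> \<open>Moving \<open>M h\<close> across the inner product turns
    \<open>r h \<bullet> \<alpha> h\<close> into \<open>\<delta> h\<close> paired with y''. The rate
    thus comes from \<open>r\<close> and needs no decay of \<open>\<delta>\<close>.\<close>
  have "(\<lambda>h. h ^ q * (r h \<bullet> \<alpha> h)) \<in> O[F](\<lambda>h. h ^ q * (h ^ n * 1))"
    by (intro landau_o.big.mult bigo_inner r \<alpha>) auto
  then have "(\<lambda>h. h ^ q * (r h \<bullet> \<alpha> h)) \<in> O[F](\<lambda>h. h ^ (n + q))" by (simp add: power_add mult.commute)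
  from sum_in_bigo(1)[OF this y_err]
  have *: "(\<lambda>h. h ^ q * (r h \<bullet> \<alpha> h) + (h ^ q * (w \<bullet> at_nodes c t h ((deriv ^^ 2) y)) - J y h))
      \<in> O[F](\<lambda>h. h ^ (n + q))" .
  have "eventually (\<lambda>h. h ^ q * (r h \<bullet> \<alpha> h) + (h ^ q * (w \<bullet> at_nodes c t h ((deriv ^^ 2) y)) - J y h)
      = h ^ q * (\<omega> h \<bullet> at_nodes c t h ((deriv ^^ 2) y)) - J y h) F"
    using M\<alpha>
  proof eventually_elim
    case (elim h)
    have "r h \<bullet> \<alpha> h = \<delta> h \<bullet> at_nodes c t h ((deriv ^^ 2) y)"
      unfolding elim[symmetric] r_def by (metis dot_lmul_matrix transpose_matrix_vector)
    then show ?case by (simp add: \<delta>_def inner_diff_left right_diff_distrib)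
  qed
  then show "(\<lambda>h. h ^ q * (\<omega> h \<bullet> at_nodes c t h ((deriv ^^ 2) y)) - J y h) \<in> O[F](\<lambda>h. h ^ (n + q))"
    using * by (rule bigo_eventually_eq)
qed

section \<open>Step order\<close>

lemma interpolatory_weights_exist:
  fixes c :: "real ^ 's::finite"
  assumes "inj (\<lambda>i. c $ i)"
  shows "\<exists>w :: real ^ 's. \<forall>k<CARD('s). (\<Sum>i\<in>UNIV. w $ i * c $ i ^ k) = \<mu> k"
proof -
  obtain e where e: "bij_betw e (UNIV :: 's set) {..<CARD('s)}"
    using ex_bij_betw_finite_nat[of "UNIV :: 's set"] by (auto simp: atLeast0LessThan)
  define V where "V = (\<chi> i k. c $ i ^ e k :: real ^ 's ^ 's)"
  \<comment> \<open>The moment equations form a square system with the transposed Vandermonde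
    matrix, so every right-hand side \<open>\<mu>\<close> is attained.\<close>
  have "invertible (transpose V)"
    using vandermonde_invertible[OF assms e] by (simp add: invertible_det_nz det_transpose V_def)
  then obtain w where w: "transpose V *v w = (\<chi> k. \<mu> (e k))"
    by (metis invertible_right_inverse matrix_right_invertible_surjective surjD)
  have "(\<Sum>i\<in>UNIV. w $ i * c $ i ^ k) = \<mu> k" if "k < CARD('s)" for k
  proof -
    have "k \<in> range e" using e that by (simp add: bij_betw_def)
    then obtain l where l: "k = e l" by auto
    show ?thesis using arg_cong[OF w, of "\<lambda>x. x $ l"]
      by (simp add: V_def transpose_def matrix_vector_mult_def mult.commute l)
  qed
  then show ?thesis by blast
qed

definition node_poly :: "real ^ 's::finite \<Rightarrow> real poly" where
  "node_poly c = (\<Prod>i\<in>UNIV. [:- c $ i, 1:])"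

lemma node_poly_simps:
  fixes c :: "real ^ 's::finite"
  shows "degree (node_poly c) = CARD('s)" and "coeff (node_poly c) (CARD('s)) = 1"
    and "poly (node_poly c) (c $ i) = 0" and "poly (node_poly c) x = (\<Prod>i\<in>UNIV. x - c $ i)"
proof -
  show deg: "degree (node_poly c) = CARD('s)"
    unfolding node_poly_def by (subst degree_prod_eq_sum_degree) auto
  have "lead_coeff (node_poly c) = 1" by (simp add: node_poly_def lead_coeff_prod)
  then show "coeff (node_poly c) (CARD('s)) = 1" by (simp only: deg)
  show eq: "poly (node_poly c) x = (\<Prod>i\<in>UNIV. x - c $ i)" for x
    by (simp add: node_poly_def poly_prod)
  show "poly (node_poly c) (c $ i) = 0" unfolding eq by (intro prod_zero bexI[of _ i]) auto
qed

text \<open>This is the coefficient form that \<open>moment_of_monic\<close> needs. Multiplication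
  by the variable is \<open>pCons 0\<close>; the index shift turns the denominators k + 1 into k +
  2.\<close>

lemma node_poly_orthogonal:
  fixes c :: "real ^ 's::finite"
  assumes "\<And>k. k \<in> {0, 1} \<Longrightarrow> integral {0..1} (\<lambda>\<xi>. \<xi> ^ (k::nat) * (\<Prod>i\<in>UNIV. \<xi> - c $ i)) = 0"
  shows "(\<Sum>k\<le>CARD('s). coeff (node_poly c) k / (k + 1)) = 0"
    and "(\<Sum>k\<le>CARD('s). coeff (node_poly c) k / (k + 2)) = 0"
proof -
  show "(\<Sum>k\<le>CARD('s). coeff (node_poly c) k / (k + 1)) = 0"
    using assms[of 0] integral_poly_unit_interval[of "node_poly c"]
    by (simp add: node_poly_simps(1) node_poly_simps(4)[abs_def])
  have "node_poly c \<noteq> 0" using node_poly_simps(2)[of c] by auto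
  then have "degree (pCons 0 (node_poly c)) = Suc (CARD('s))" by (simp add: node_poly_simps)
  moreover have "poly (pCons 0 (node_poly c)) = (\<lambda>\<xi>. \<xi> ^ 1 * (\<Prod>i\<in>UNIV. \<xi> - c $ i))"
    by (rule ext) (simp add: node_poly_simps(4))
  ultimately show "(\<Sum>k\<le>CARD('s). coeff (node_poly c) k / (k + 2)) = 0"
    using assms[of 1] integral_poly_unit_interval[of "pCons 0 (node_poly c)"]
    by (simp add: sum.atMost_Suc_shift add.commute del: sum.atMost_Suc)
qed

text \<open>The Gauss effect: the two conditions extend exactness to the powers s and s + 1, through
  the node polynomial and its product with the variable.\<close>

lemma velocity_weights_exist:
  fixes c :: "real ^ 's::finite"
  assumes "inj (\<lambda>i. c $ i)"
    and orth: "\<And>k. k \<in> {0, 1} \<Longrightarrow>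
      integral {0..1} (\<lambda>\<xi>. \<xi> ^ (k::nat) * (\<Prod>i\<in>UNIV. \<xi> - c $ i)) = 0"
  shows "\<exists>w :: real ^ 's. \<forall>k<CARD('s) + 2. (\<Sum>i\<in>UNIV. w $ i * c $ i ^ k) = 1 / real (k + 1)"
proof -
  obtain w :: "real ^ 's" where w: "\<And>k. k < CARD('s) \<Longrightarrow> (\<Sum>i\<in>UNIV. w $ i * c $ i ^ k) = 1 / real (k + 1)"
    using interpolatory_weights_exist[OF assms(1), of "\<lambda>k. 1 / real (k + 1)"] by blast
  have w0: "(\<Sum>i\<in>UNIV. w $ i * c $ i ^ CARD('s)) = 1 / real (CARD('s) + 1)"
    using moment_of_monic[of "node_poly c" w c "\<lambda>k. 1 / real (k + 1)"] w node_poly_orthogonal(1)[OF orth]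
    by (simp add: node_poly_simps(1,2,3))
  have "node_poly c \<noteq> 0" using node_poly_simps(2)[of c] by auto
  then have deg: "degree (pCons 0 (node_poly c)) = Suc (CARD('s))" by (simp add: node_poly_simps)
  \<comment> \<open>For the polynomial of degree s + 1 the lower moments must include the one just
    gained in \<open>w0\<close>.\<close>
  have "(\<Sum>i\<in>UNIV. w $ i * c $ i ^ k) = 1 / real (k + 1)" if "k < Suc (CARD('s))" for k
    using that w w0 by (cases "k = CARD('s)") auto
  then have "(\<Sum>i\<in>UNIV. w $ i * c $ i ^ Suc (CARD('s))) = 1 / real (Suc (CARD('s)) + 1)"
    using moment_of_monic[of "pCons 0 (node_poly c)" w c "\<lambda>k. 1 / real (k + 1)"] node_poly_orthogonal(2)[OF orth]
    unfolding deg
    by (simp add: node_poly_simps(2,3) sum.atMost_Suc_shift add.commute del: sum.atMost_Suc)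
  with w w0 show ?thesis
    by (intro exI[of _ w]) (auto simp: less_Suc_eq simp flip: Suc_eq_plus1)
qed

text \<open>The targets are the integrals of (1 - x) x^k over [0, 1], and the power s is gained from
  orthogonality of the node polynomial to 1 - x. One extra power suffices, as the position formula
  carries h^2.\<close>

lemma position_weights_exist:
  fixes c :: "real ^ 's::finite"
  assumes "inj (\<lambda>i. c $ i)"
    and orth: "\<And>k. k \<in> {0, 1} \<Longrightarrow>
      integral {0..1} (\<lambda>\<xi>. \<xi> ^ (k::nat) * (\<Prod>i\<in>UNIV. \<xi> - c $ i)) = 0"
  shows "\<exists>w :: real ^ 's. \<forall>k<CARD('s) + 1. (\<Sum>i\<in>UNIV. w $ i * c $ i ^ k) = 1 / real ((k + 1) * (k + 2))"
proof -
  let ?\<mu> = "\<lambda>k. 1 / real ((k + 1) * (k + 2))"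
  obtain w :: "real ^ 's" where w: "\<And>k. k < CARD('s) \<Longrightarrow> (\<Sum>i\<in>UNIV. w $ i * c $ i ^ k) = ?\<mu> k"
    using interpolatory_weights_exist[OF assms(1), of ?\<mu>] by blast
  \<comment> \<open>Partial fractions reduce the sum to the difference of the two orthogonality
    relations.\<close>
  have "(\<Sum>k\<le>CARD('s). coeff (node_poly c) k * ?\<mu> k) =
      (\<Sum>k\<le>CARD('s). coeff (node_poly c) k / (k + 1) - coeff (node_poly c) k / (k + 2))"
    by (intro sum.cong refl) (simp add: field_simps add_eq_0_iff)
  also have "\<dots> = 0" using node_poly_orthogonal[OF orth] by (simp add: sum_subtractf)
  finally have "(\<Sum>i\<in>UNIV. w $ i * c $ i ^ CARD('s)) = ?\<mu> (CARD('s))"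
    using moment_of_monic[of "node_poly c" w c ?\<mu>] w
    by (simp add: node_poly_simps(1,2,3) del: of_nat_mult of_nat_add of_nat_Suc)
  with w show ?thesis
    by (intro exI[of _ w]) (auto simp: less_Suc_eq simp flip: Suc_eq_plus1)
qed

text \<open>The factor in \<open>a\<close> is the integral of (1 + a - x) x^k over [1, 1 + a]. The
  sum expands about \<open>t\<close> because the weights act on nodal values around
  \<open>t\<close>; it combines position expansions at 1 + a and 1 with the velocity expansion at
  1.\<close>

lemma taylor_stage:
  assumes "Ck_on (n + 2) D v" and "open D" and "t \<in> D" and F: "F \<le> nhds 0"
  shows "(\<lambda>h. v (t + h + a * h) - v (t + h) - h * deriv v (t + h) * a
           - h\<^sup>2 * (\<Sum>k<n. (deriv ^^ k) ((deriv ^^ 2) v) t / fact k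
               * (((1 + a) ^ (k + 2) - 1 - a * (k + 2)) / ((k + 1) * (k + 2))) * h ^ k))
         \<in> O[F](\<lambda>h. h ^ (n + 2))"
proof -
  let ?g = "\<lambda>k. (deriv ^^ k) ((deriv ^^ 2) v) t / fact k"
  let ?S = "\<lambda>b h. \<Sum>k<n. ?g k * (b ^ (k + 2) / ((k + 1) * (k + 2))) * h ^ k"
  let ?S' = "\<lambda>h. \<Sum>k<n. ?g k * (1 ^ (k + 1) / (k + 1)) * h ^ k"
  have pos: "(\<lambda>h. v (t + b * h) - v t - b * h * deriv v t - h\<^sup>2 * ?S b h) \<in> O[F](\<lambda>h. h ^ (n + 2))" for b
    by (rule taylor_second_derivative[OF assms])
  have "(\<lambda>h. (a * h) * (deriv v (t + 1 * h) - deriv v t - h * ?S' h)) \<in> O[F](\<lambda>h. h * h ^ (n + 1))"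
    by (intro landau_o.big.mult taylor_first_derivative[OF assms]) simp
  then have vel: "(\<lambda>h. (a * h) * (deriv v (t + 1 * h) - deriv v t - h * ?S' h)) \<in> O[F](\<lambda>h. h ^ (n + 2))"
    by simp
  have S: "?S (1 + a) h - ?S 1 h - a * ?S' h
      = (\<Sum>k<n. ?g k * (((1 + a) ^ (k + 2) - 1 - a * (k + 2)) / ((k + 1) * (k + 2))) * h ^ k)" for h
    unfolding sum_distrib_left sum_subtractf[symmetric]
  proof (intro sum.cong refl)
    fix k :: nat
    \<comment> \<open>Stated for free variables, so that the only arithmetic in \<open>k\<close> is
      the fraction identity assumed of \<open>R\<close>, \<open>S\<close> and
      \<open>Q\<close>.\<close>
    have "g * (x / Q) * z - g * (1 ^ m / Q) * z - a * (g * (1 ^ l / R) * z) = g * ((x - 1 - a * S) / Q) * z"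
      if "a / R = a * S / Q" for g x z Q R S :: real and l m :: nat
    proof -
      have "a * (g * (1 ^ l / R) * z) = g * (a / R) * z" by simp
      also have "\<dots> = g * (a * S / Q) * z" by (simp only: that)
      finally have "a * (g * (1 ^ l / R) * z) = g * (a * S / Q) * z" .
      then show ?thesis
        by (simp only: power_one diff_divide_distrib right_diff_distrib left_diff_distrib)
    qed
    moreover have "a / (k + 1) = a * (k + 2) / ((k + 1) * (k + 2))"
      unfolding of_nat_mult by (rule mult_divide_mult_cancel_right[symmetric]) simp
    ultimately show "?g k * ((1 + a) ^ (k + 2) / ((k + 1) * (k + 2))) * h ^ k
        - ?g k * (1 ^ (k + 2) / ((k + 1) * (k + 2))) * h ^ k
        - a * (?g k * (1 ^ (k + 1) / (k + 1)) * h ^ k)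
      = ?g k * (((1 + a) ^ (k + 2) - 1 - a * (k + 2)) / ((k + 1) * (k + 2))) * h ^ k"
      by this
  qed
  from sum_in_bigo(2)[OF sum_in_bigo(2)[OF pos[of "1 + a"] pos[of 1]] vel]
  show ?thesis
    unfolding S[symmetric] by (simp add: algebra_simps power2_eq_square)
qed

text \<open>Each error component splits into the fitted quadrature error for exact stages, bounded
  by \<open>fitted_weights\<close>, and the fitted weights applied to \<open>\<eta>\<close>, the
  error in \<open>f\<close> caused by inexact stages.\<close>

lemma feptrkn_step_order:
  fixes u :: "'s::finite \<Rightarrow> real \<Rightarrow> real" and c :: "real ^ 's"
  assumes "open D" and "t \<in> D"
    and lipschitz: "\<And>x. x \<in> D \<Longrightarrow> L-lipschitz_on UNIV (f x)"
    and ode: "\<And>x. x \<in> D \<Longrightarrow> (deriv ^^ 2) y x = f x (y x)"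
    and y: "Ck_on (CARD('s) + 4) D y"
    and u: "\<And>i. Ck_on (CARD('s) + 4) D (u i)"
    and c: "inj (\<lambda>i. c $ i)"
    and coefficients: "\<And>h. h > 0 \<Longrightarrow> invertible (F_matrix u c t h) \<Longrightarrow>
           fitted u c t h (A t h) (b t h) (d t h)"
    and orth: "\<And>k. k \<in> {0, 1} \<Longrightarrow>
      integral {0..1} (\<lambda>\<xi>. \<xi> ^ (k::nat) * (\<Prod>i\<in>UNIV. \<xi> - c $ i)) = 0"
    and wronskian: "wronskian_nonzero u t"
  shows "has_step_order u c A b d f y t (CARD('s) + 2)"
proof -
  define F where "F = step_filter u c t"
  have F: "F \<le> at_right 0" unfolding F_def step_filter_def by (intro at_le) auto
  have F0: "F \<le> nhds 0" using F by (metis at_within_def inf.boundedE)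
  have ev: "eventually (\<lambda>h. h > 0 \<and> invertible (F_matrix u c t h)) F"
    by (auto simp: F_def step_filter_def eventually_at_filter)
  have fit: "eventually (\<lambda>h. fitted u c t h (A t h) (b t h) (d t h)) F"
    using ev by eventually_elim (auto intro: coefficients)
  have inv: "eventually (\<lambda>h. invertible (F_matrix u c t h)) F"
    using ev by eventually_elim simp
  obtain e where e: "bij_betw e (UNIV :: 's set) {..<CARD('s)}"
    and W: "invertible (\<chi> k j. (deriv ^^ e k) ((deriv ^^ 2) (u j)) t :: real ^ 's ^ 's)"
    using wronskian by (auto simp: wronskian_nonzero_def invertible_det_nz)
  \<comment> \<open>The velocity expansion uses s + 2 terms of v'', hence smoothness of order s +
    4.\<close>
  have low: "Ck_on (n + 2) D v" and g: "Ck_on n D ((deriv ^^ 2) v)"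
    if "Ck_on (CARD('s) + 4) D v" "n \<le> CARD('s) + 2" for v n
    using Ck_on_deriv[OF that(1), of 0 "n + 2"] Ck_on_deriv[OF that(1), of 2 n] that(2) by simp_all
  have low0: "Ck_on (CARD('s) + 2) D v" if "Ck_on (CARD('s) + 4) D v" for v
    using low[OF that, of "CARD('s)"] by simp
  note weights = fitted_weights[OF assms(1,2) F c e W low0[OF u] low0[OF y] inv]
  let ?nodes = "\<lambda>v h. at_nodes c t h ((deriv ^^ 2) v)"

  define Jd where "Jd v h = deriv v (t + h) - deriv v t" for v h
  obtain wd :: "real ^ 's" where wd: "\<And>k. k < CARD('s) + 2 \<Longrightarrow> (\<Sum>i\<in>UNIV. wd $ i * c $ i ^ k) = 1 / real (k + 1)"
    using velocity_weights_exist[OF c orth] by blast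
  have err_d: "(\<lambda>h. h ^ 1 * (wd \<bullet> ?nodes v h) - Jd v h) \<in> O[F](\<lambda>h. h ^ (CARD('s) + 2 + 1))"
    if "Ck_on (CARD('s) + 4) D v" for v
    proof (rule quadrature_error[where \<mu> = "\<lambda>k. 1 / real (k + 1)"])
      show "Ck_on (CARD('s) + 2) D ((deriv ^^ 2) v)" by (rule g[OF that]) simp
      show "(\<Sum>i\<in>UNIV. wd $ i * c $ i ^ k) = (\<lambda>k. 1 / real (k + 1)) k" if "k < CARD('s) + 2" for k
        using wd[OF that] .
      show "(\<lambda>h. Jd v h - h ^ 1 * (\<Sum>k<CARD('s) + 2. (deriv ^^ k) ((deriv ^^ 2) v) t / fact k
          * (\<lambda>k. 1 / real (k + 1)) k * h ^ k)) \<in> O[F](\<lambda>h. h ^ (CARD('s) + 2 + 1))"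
        using taylor_first_derivative[OF low[OF that] assms(1,2) F0, of "CARD('s) + 2" 1]
        by (simp add: Jd_def)
    qed (use assms(1,2) F0 in auto)
  have "eventually (\<lambda>h. h ^ 1 * (d t h \<bullet> ?nodes (u i) h) = Jd (u i) h) F" for i
    using fit by eventually_elim (auto simp: fitted_def Let_def Jd_def)
  note d = weights[OF this err_d[OF u] err_d[OF y]]

  \<comment> \<open>Velocity has \<open>n = s + 2\<close> and \<open>q = 1\<close>, position
    \<open>n = s + 1\<close> and \<open>q = 2\<close>: both errors are O(h^(s + 3)).\<close>
  define Jb where "Jb v h = v (t + h) - v t - h * deriv v t" for v h
  obtain wb :: "real ^ 's" where wb: "\<And>k. k < CARD('s) + 1 \<Longrightarrow>
      (\<Sum>i\<in>UNIV. wb $ i * c $ i ^ k) = 1 / real ((k + 1) * (k + 2))"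
    using position_weights_exist[OF c orth] by blast
  have err_b: "(\<lambda>h. h\<^sup>2 * (wb \<bullet> ?nodes v h) - Jb v h) \<in> O[F](\<lambda>h. h ^ (CARD('s) + 1 + 2))"
    if "Ck_on (CARD('s) + 4) D v" for v
    proof (rule quadrature_error[where \<mu> = "\<lambda>k. 1 / real ((k + 1) * (k + 2))"])
      show "Ck_on (CARD('s) + 1) D ((deriv ^^ 2) v)" by (rule g[OF that]) simp
      show "(\<Sum>i\<in>UNIV. wb $ i * c $ i ^ k) = (\<lambda>k. 1 / real ((k + 1) * (k + 2))) k" if "k < CARD('s) + 1" for k
        using wb[OF that] .
      show "(\<lambda>h. Jb v h - h ^ 2 * (\<Sum>k<CARD('s) + 1. (deriv ^^ k) ((deriv ^^ 2) v) t / fact k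
          * (\<lambda>k. 1 / real ((k + 1) * (k + 2))) k * h ^ k)) \<in> O[F](\<lambda>h. h ^ (CARD('s) + 1 + 2))"
        using taylor_second_derivative[OF low[OF that] assms(1,2) F0, of "CARD('s) + 1" 1]
        by (simp add: Jb_def)
    qed (use assms(1,2) F0 in auto)
  have "eventually (\<lambda>h. h\<^sup>2 * (b t h \<bullet> ?nodes (u i) h) = Jb (u i) h) F" for i
    using fit by eventually_elim (auto simp: fitted_def Let_def Jb_def)
  note b = weights[OF this err_b[OF u] err_b[OF y]]

  \<comment> \<open>Row \<open>i\<close> of \<open>A\<close> acts as the weight vector of stage
    \<open>i\<close>. With \<open>n = s\<close> and \<open>q = 2\<close> its error is O(h^(s + 2)),
    the accuracy demanded of the stages.\<close>
  define Ja where "Ja i v h = v (t + h + c $ i * h) - v (t + h) - h * deriv v (t + h) * c $ i" for i v h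
  have a: "(\<lambda>h. norm (A t h $ i)) \<in> O[F](\<lambda>_. 1)"
    "(\<lambda>h. h\<^sup>2 * (A t h $ i \<bullet> ?nodes y h) - Ja i y h) \<in> O[F](\<lambda>h. h ^ (CARD('s) + 2))" for i
  proof -
    let ?\<mu> = "\<lambda>k::nat. ((1 + c $ i) ^ (k + 2) - 1 - c $ i * (k + 2)) / ((k + 1) * (k + 2))"
    obtain wa :: "real ^ 's" where wa: "\<And>k. k < CARD('s) \<Longrightarrow> (\<Sum>i\<in>UNIV. wa $ i * c $ i ^ k) = ?\<mu> k"
      using interpolatory_weights_exist[OF c, of ?\<mu>] by blast
    have err_a: "(\<lambda>h. h\<^sup>2 * (wa \<bullet> ?nodes v h) - Ja i v h) \<in> O[F](\<lambda>h. h ^ (CARD('s) + 2))"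
      if "Ck_on (CARD('s) + 4) D v" for v
    proof (rule quadrature_error[where \<mu> = "?\<mu>"])
      show "Ck_on (CARD('s)) D ((deriv ^^ 2) v)" by (rule g[OF that]) simp
      show "(\<Sum>i\<in>UNIV. wa $ i * c $ i ^ k) = (?\<mu>) k" if "k < CARD('s)" for k
        using wa[OF that] .
      show "(\<lambda>h. Ja i v h - h ^ 2 * (\<Sum>k<CARD('s). (deriv ^^ k) ((deriv ^^ 2) v) t / fact k
          * (?\<mu>) k * h ^ k)) \<in> O[F](\<lambda>h. h ^ (CARD('s) + 2))"
        using taylor_stage[OF low[OF that] assms(1,2) F0, of "CARD('s)" "c $ i"]
        by (simp add: Ja_def)
    qed (use assms(1,2) F0 in auto)
    have "eventually (\<lambda>h. h\<^sup>2 * (A t h $ i \<bullet> ?nodes (u j) h) = Ja i (u j) h) F" for j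
      using fit
    proof eventually_elim
      case (elim h)
      then have "at_nodes c (t + h) h (u j) $ i =
          (vec (u j (t + h)) + (h * deriv (u j) (t + h)) *\<^sub>R c + h\<^sup>2 *\<^sub>R (A t h *v ?nodes (u j) h)) $ i"
        by (simp only: fitted_def Let_def)
      then show ?case
        by (simp add: Ja_def at_nodes_def matrix_vector_mult_def inner_vec_def)
    qed
    note a = weights[OF this err_a[OF u] err_a[OF y]]
    show "(\<lambda>h. norm (A t h $ i)) \<in> O[F](\<lambda>_. 1)"
      "(\<lambda>h. h\<^sup>2 * (A t h $ i \<bullet> ?nodes y h) - Ja i y h) \<in> O[F](\<lambda>h. h ^ (CARD('s) + 2))"
      using a by auto
  qed

  have "has_orders u c A b d f y t (CARD('s) + 2) (CARD('s) + 2) (CARD('s) + 1)"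
    unfolding has_orders_def F_def[symmetric]
  proof (intro allI impI)
    fix Y
    assume Y: "(\<lambda>h. norm (at_nodes c t h y - Y h)) \<in> O[F](\<lambda>h. h ^ (CARD('s) + 1 + 1))"
    define \<phi> where "\<phi> h = f_at_nodes c t h f (Y h)" for h
    define \<eta> where "\<eta> h = ?nodes y h - \<phi> h" for h
    have \<eta>: "(\<lambda>h. norm (\<eta> h)) \<in> O[F](\<lambda>h. h ^ (CARD('s) + 2))"
    proof (rule bigo_norm_vec)
      fix i
      have "((\<lambda>h. t + c $ i * h) \<longlongrightarrow> t + c $ i * 0) F"
        using F0 by (intro tendsto_intros) (simp add: filterlim_def)
      \<comment> \<open>The differential equation and the Lipschitz bound are available only on
        \<open>D\<close>, which contains the nodes once \<open>h\<close> is small.\<close>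
      then have "eventually (\<lambda>h. t + c $ i * h \<in> D) F"
        using assms(1,2) by (auto dest: topological_tendstoD)
      then have "eventually (\<lambda>h. norm (\<eta> h $ i) \<le> L * norm (norm (at_nodes c t h y - Y h))) F"
      proof eventually_elim
        case (elim h)
        let ?x = "t + c $ i * h"
        have "norm (\<eta> h $ i) = dist (f ?x (y ?x)) (f ?x (Y h $ i))"
          by (simp add: \<eta>_def \<phi>_def at_nodes_def f_at_nodes_def ode[OF elim] dist_real_def)
        also have "\<dots> \<le> L * dist (y ?x) (Y h $ i)"
          using lipschitz_onD[OF lipschitz[OF elim]] by simp
        also have "\<dots> \<le> L * norm (at_nodes c t h y - Y h)"
          using component_le_norm_cart[of "at_nodes c t h y - Y h" i] lipschitz_on_nonneg[OF lipschitz[OF elim]]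
          by (intro mult_left_mono) (auto simp: at_nodes_def dist_real_def)
        finally show ?case by simp
      qed
      then have "(\<lambda>h. \<eta> h $ i) \<in> O[F](\<lambda>h. norm (at_nodes c t h y - Y h))" by (rule bigoI)
      then show "(\<lambda>h. \<eta> h $ i) \<in> O[F](\<lambda>h. h ^ (CARD('s) + 2))"
        using Y[unfolded add.assoc one_add_one] by (rule landau_o.big_trans)
    qed
    \<comment> \<open>For the velocity, \<open>q = 1\<close> and \<open>m = s + 3\<close>, so the
      stage accuracy O(h^(s + 2)) is used up exactly.\<close>
    have perturbation: "(\<lambda>h. h ^ q * (\<omega> h \<bullet> \<eta> h)) \<in> O[F](\<lambda>h. h ^ m)"
      if "(\<lambda>h. norm (\<omega> h)) \<in> O[F](\<lambda>_. 1)" "m \<le> q + (CARD('s) + 2)" for \<omega> q m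
    proof -
      have "(\<lambda>h. h ^ q * (\<omega> h \<bullet> \<eta> h)) \<in> O[F](\<lambda>h. h ^ q * (1 * h ^ (CARD('s) + 2)))"
        by (intro landau_o.big.mult bigo_inner that \<eta>) simp
      also have "(\<lambda>h::real. h ^ q * (1 * h ^ (CARD('s) + 2))) = (\<lambda>h. h ^ (q + (CARD('s) + 2)))"
        by (simp only: power_add mult_1_left)
      finally show ?thesis using at_right_power_bigo[OF F that(2)] by (rule landau_o.big_trans)
    qed
    define z where "z h = y t + h * deriv y t + h\<^sup>2 * (b t h \<bullet> \<phi> h)" for h
    define z' where "z' h = deriv y t + h * (d t h \<bullet> \<phi> h)" for h
    have z': "(\<lambda>h. deriv y (t + h) - z' h) \<in> O[F](\<lambda>h. h ^ (CARD('s) + 2 + 1))"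
    proof -
      have "(\<lambda>h. h ^ 1 * (d t h \<bullet> \<eta> h) - (h ^ 1 * (d t h \<bullet> ?nodes y h) - Jd y h))
          \<in> O[F](\<lambda>h. h ^ (CARD('s) + 2 + 1))"
        by (rule sum_in_bigo(2)[OF perturbation d(2)]) (use d(1) in simp_all)
      then show ?thesis
        by (simp add: z'_def Jd_def \<eta>_def inner_diff_right algebra_simps)
    qed
    have z: "(\<lambda>h. y (t + h) - z h) \<in> O[F](\<lambda>h. h ^ (CARD('s) + 2 + 1))"
    proof -
      have "(\<lambda>h. h ^ 2 * (b t h \<bullet> \<eta> h) - (h ^ 2 * (b t h \<bullet> ?nodes y h) - Jb y h))
          \<in> O[F](\<lambda>h. h ^ (CARD('s) + 1 + 2))"
        by (rule sum_in_bigo(2)[OF perturbation b(2)]) (use b(1) in simp_all)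
      then show ?thesis
        by (simp add: z_def Jb_def \<eta>_def inner_diff_right algebra_simps)
    qed
    have "(\<lambda>h. norm (at_nodes c (t + h) h y - (vec (z h) + (h * z' h) *\<^sub>R c + h\<^sup>2 *\<^sub>R (A t h *v \<phi> h))))
        \<in> O[F](\<lambda>h. h ^ (CARD('s) + 2))"
    proof (rule bigo_norm_vec)
      fix i
      have "(\<lambda>h. (c $ i * h) * (deriv y (t + h) - z' h)) \<in> O[F](\<lambda>h. h * h ^ (CARD('s) + 2 + 1))"
        by (intro landau_o.big.mult z') simp
      also have "(\<lambda>h. h * h ^ (CARD('s) + 2 + 1)) \<in> O[F](\<lambda>h. h ^ (CARD('s) + 2))"
        using at_right_power_bigo[OF F, of "CARD('s) + 2" "Suc (CARD('s) + 2 + 1)"] by simp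
      finally have vel: "(\<lambda>h. (c $ i * h) * (deriv y (t + h) - z' h)) \<in> O[F](\<lambda>h. h ^ (CARD('s) + 2))" .
      have pos: "(\<lambda>h. y (t + h) - z h) \<in> O[F](\<lambda>h. h ^ (CARD('s) + 2))"
        by (rule landau_o.big_trans[OF z at_right_power_bigo[OF F]]) simp
      have "(\<lambda>h. (y (t + h) - z h) + (c $ i * h) * (deriv y (t + h) - z' h)
          + (h\<^sup>2 * (A t h $ i \<bullet> \<eta> h) - (h\<^sup>2 * (A t h $ i \<bullet> ?nodes y h) - Ja i y h)))
          \<in> O[F](\<lambda>h. h ^ (CARD('s) + 2))"
        by (intro sum_in_bigo(1) pos vel, rule sum_in_bigo(2)[OF perturbation a(2)])
           (use a(1) in simp_all)
      moreover have "(at_nodes c (t + h) h y - (vec (z h) + (h * z' h) *\<^sub>R c + h\<^sup>2 *\<^sub>R (A t h *v \<phi> h))) $ i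
          = (y (t + h) - z h) + (c $ i * h) * (deriv y (t + h) - z' h)
          + (h\<^sup>2 * (A t h $ i \<bullet> \<eta> h) - (h\<^sup>2 * (A t h $ i \<bullet> ?nodes y h) - Ja i y h))" for h
      proof -
        have stage: "(A t h *v \<phi> h) $ i = A t h $ i \<bullet> ?nodes y h - A t h $ i \<bullet> \<eta> h"
          by (simp add: \<eta>_def inner_diff_right) (simp add: matrix_vector_mult_def inner_vec_def)
        have "(at_nodes c (t + h) h y - (vec (z h) + (h * z' h) *\<^sub>R c + h\<^sup>2 *\<^sub>R (A t h *v \<phi> h))) $ i
            = y (t + h + c $ i * h) - (z h + h * z' h * c $ i + h\<^sup>2 * (A t h *v \<phi> h) $ i)"
          by (simp add: at_nodes_def)
        then show ?thesis unfolding stage Ja_def by (simp add: algebra_simps)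
      qed
      ultimately show "(\<lambda>h. (at_nodes c (t + h) h y
            - (vec (z h) + (h * z' h) *\<^sub>R c + h\<^sup>2 *\<^sub>R (A t h *v \<phi> h))) $ i) \<in> O[F](\<lambda>h. h ^ (CARD('s) + 2))"
        by (simp only:)
    qed
    with z z' show "let new = (\<lambda>h. feptrkn_step c (A t h) (b t h) (d t h) f t h (y t, deriv y t, Y h)) in
          (\<lambda>h. y (t + h) - fst (new h)) \<in> O[F](\<lambda>h. h ^ (CARD('s) + 2 + 1)) \<and>
          (\<lambda>h. deriv y (t + h) - fst (snd (new h))) \<in> O[F](\<lambda>h. h ^ (CARD('s) + 2 + 1)) \<and>
          (\<lambda>h. norm (at_nodes c (t + h) h y - snd (snd (new h)))) \<in> O[F](\<lambda>h. h ^ (CARD('s) + 1 + 1))"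
      by (simp add: feptrkn_step_def Let_def z_def z'_def \<phi>_def)
  qed
  then show ?thesis unfolding has_step_order_def by (metis min.idem)
qed

section \<open>Vanishing Wronskians\<close>

text \<open>
  Padding with the identity keeps the leading \<open>m \<times> m\<close> Wronskian matrix in the fixed type
  \<^typ>\<open>real ^ 's ^ 's\<close>, so that the induction on \<open>m\<close> does not change the type.
\<close>

definition padded_wronskian ::
  "('s \<Rightarrow> nat) \<Rightarrow> ('s::finite \<Rightarrow> real \<Rightarrow> real) \<Rightarrow> nat \<Rightarrow> real \<Rightarrow> real ^ 's ^ 's" where
  "padded_wronskian e g m t =
     (\<chi> k j. if e k < m \<and> e j < m then (deriv ^^ e k) (g j) t else if k = j then 1 else 0)"

text \<open>On vectors supported in the leading block the padding is invisible.\<close>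

lemma padded_wronskian_mult_nth:
  assumes "\<And>j. m \<le> e j \<Longrightarrow> x $ j = 0"
  shows "(padded_wronskian e g m t *v x) $ k =
    (if e k < m then \<Sum>j\<in>UNIV. (deriv ^^ e k) (g j) t * x $ j else 0)"
proof (cases "e k < m")
  case True
  have eq: "padded_wronskian e g m t $ k $ j * x $ j = (deriv ^^ e k) (g j) t * x $ j" for j
    using True assms[of j] by (cases "e j < m") (auto simp: padded_wronskian_def)
  show ?thesis using True by (simp add: matrix_vector_mult_def eq)
next
  case False
  have eq: "padded_wronskian e g m t $ k $ j * x $ j = 0" for j
    using False assms[of j] by (cases "e j < m") (auto simp: padded_wronskian_def)
  show ?thesis using False by (simp add: matrix_vector_mult_def eq)
qed

text \<open>The identity rows force a kernel vector to vanish outside the leading block, so it is a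
  genuine relation between the columns of that block.\<close>

lemma padded_wronskian_singular:
  assumes "\<not> invertible (padded_wronskian e g m t)"
  shows "\<exists>x. x \<noteq> 0 \<and> (\<forall>j. m \<le> e j \<longrightarrow> x $ j = 0)
    \<and> (\<forall>k. e k < m \<longrightarrow> (\<Sum>j\<in>UNIV. (deriv ^^ e k) (g j) t * x $ j) = 0)"
proof -
  obtain x where x: "padded_wronskian e g m t *v x = 0" "x \<noteq> 0"
    using assms by (auto simp: invertible_left_inverse matrix_left_invertible_ker)
  have supp: "x $ j = 0" if "m \<le> e j" for j
  proof -
    have eq: "padded_wronskian e g m t $ j $ i * x $ i = (if i = j then x $ i else 0)" for i
      using that by (simp add: padded_wronskian_def)
    show ?thesis using arg_cong[OF x(1), of "\<lambda>x. x $ j"]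
      by (simp add: matrix_vector_mult_def eq)
  qed
  have "(\<Sum>j\<in>UNIV. (deriv ^^ e k) (g j) t * x $ j) = 0" if "e k < m" for k
    using padded_wronskian_mult_nth[of m e x g t k] supp that x by simp
  with supp x show ?thesis by blast
qed

lemma padded_wronskian_tendsto:
  assumes "\<And>j. Ck_on m D (g j)" and "open D" and "t \<in> D"
  shows "(padded_wronskian e g m \<longlongrightarrow> padded_wronskian e g m t) (at t)"
proof (intro vec_tendstoI)
  fix k j
  show "((\<lambda>x. padded_wronskian e g m x $ k $ j) \<longlongrightarrow> padded_wronskian e g m t $ k $ j) (at t)"
  proof (cases "e k < m \<and> e j < m")
    case True
    then have "isCont ((deriv ^^ e k) (g j)) t"
      using assms by (intro differentiable_imp_continuous_within) (auto simp: Ck_on_def)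
    then show ?thesis using True by (simp add: padded_wronskian_def isCont_def)
  qed (auto simp: padded_wronskian_def)
qed

lemma DERIV_0_if_smallo:
  fixes \<alpha> :: "real \<Rightarrow> real"
  assumes "(\<lambda>x. \<alpha> x - \<alpha> t) \<in> o[at t](\<lambda>x. x - t)"
  shows "(\<alpha> has_real_derivative 0) (at t)"
  using smalloD_tendsto[OF assms] by (simp add: has_field_derivative_iff)

text \<open>Only a subinterval can be claimed: x^2 and x |x| have zero Wronskian but are independent
  near 0. In the induction step, either the smaller Wronskian vanishes throughout, or it is nonzero
  on a subinterval, where the normalised kernel vector of the larger one turns out to be
  constant.\<close>

lemma wronskian_vanishing_imp_dependent:
  fixes g :: "'s::finite \<Rightarrow> real \<Rightarrow> real"
  assumes "a < b" and e: "bij_betw e (UNIV :: 's set) {..<CARD('s)}" and "m \<le> CARD('s)"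
    and g: "\<And>j. Ck_on m {a<..<b} (g j)"
    and "\<And>t. t \<in> {a<..<b} \<Longrightarrow> \<not> invertible (padded_wronskian e g m t)"
  shows "\<exists>a' b' x. a \<le> a' \<and> a' < b' \<and> b' \<le> b \<and> x \<noteq> 0 \<and>
    (\<forall>t\<in>{a'<..<b'}. (\<Sum>j\<in>UNIV. g j t * x $ j) = 0)"
  using assms
proof (induction m arbitrary: a b)
  case 0
  \<comment> \<open>For \<open>m = 0\<close> the padded matrix is the identity, so one point gives a
    contradiction.\<close>
  define t where "t = (a + b) / 2"
  have "t \<in> {a<..<b}" using \<open>a < b\<close> by (simp add: t_def)
  from padded_wronskian_singular[OF 0(5)[OF this]] show ?case by (auto simp: vec_eq_iff)
next
  case (Suc m)
  have g: "Ck_on m {a<..<b} (g j)" for j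
    using Ck_on_deriv[OF Suc.prems(4), of 0 m] by simp
  show ?case
  proof (cases "\<forall>t\<in>{a<..<b}. \<not> invertible (padded_wronskian e g m t)")
    case True
    then show ?thesis using Suc.IH[OF Suc.prems(1,2) _ g] Suc.prems(3) by simp
  next
    case False
    then obtain \<tau> where \<tau>: "\<tau> \<in> {a<..<b}" "invertible (padded_wronskian e g m \<tau>)" by blast
    have lim: "(padded_wronskian e g m \<longlongrightarrow> padded_wronskian e g m t) (at t)" if "t \<in> {a<..<b}" for t
      using g that by (intro padded_wronskian_tendsto) auto
    have "((\<lambda>t. det (padded_wronskian e g m t)) \<longlongrightarrow> det (padded_wronskian e g m \<tau>)) (at \<tau>)"
      unfolding det_def by (intro tendsto_intros lim[OF \<tau>(1)])
    then have "eventually (\<lambda>t. det (padded_wronskian e g m t) \<noteq> 0) (at \<tau>)"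
      using \<tau>(2) by (intro tendsto_imp_eventually_ne) (auto simp: invertible_det_nz)
    then have "eventually (\<lambda>t. invertible (padded_wronskian e g m t) \<and> t \<in> {a<..<b}) (nhds \<tau>)"
      using \<tau> eventually_nhds_in_open[of "{a<..<b}" \<tau>]
      by (auto simp: invertible_det_nz eventually_at_filter elim: eventually_elim2)
    then obtain r where r: "r > 0"
      "\<And>t. dist t \<tau> < r \<Longrightarrow> invertible (padded_wronskian e g m t) \<and> t \<in> {a<..<b}"
      by (auto simp: eventually_nhds_metric)
    \<comment> \<open>Half the radius keeps the closed interval inside the ball, so
      \<open>near\<close> also applies to the endpoints.\<close>
    define a' b' where "a' = \<tau> - r / 2" and "b' = \<tau> + r / 2"
    have near: "dist t \<tau> < r" if "t \<in> {a'..b'}" for t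
      using that r(1) by (auto simp: a'_def b'_def dist_real_def abs_less_iff)
    have "a' < b'" using r(1) by (simp add: a'_def b'_def)
    then have sub: "a \<le> a'" "b' \<le> b" using r(2)[OF near, of a'] r(2)[OF near, of b'] by auto
    have inv: "invertible (padded_wronskian e g m t)" and mem: "t \<in> {a<..<b}" if "t \<in> {a'<..<b'}" for t
      using r(2)[OF near] that by auto

    have "m \<in> range e" using e Suc.prems(3) by (auto simp: bij_betw_def)
    then obtain n where n: "e n = m" by auto
    have e_inj: "j = k" if "e j = e k" for j k
      using e that by (auto simp: bij_betw_def inj_def)
    have "\<exists>x. x $ n = 1 \<and> (\<forall>j. m < e j \<longrightarrow> x $ j = 0) \<and>
        (\<forall>k. e k \<le> m \<longrightarrow> (\<Sum>j\<in>UNIV. (deriv ^^ e k) (g j) t * x $ j) = 0)" if t: "t \<in> {a'<..<b'}" for t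
    proof -
      obtain x where x: "x \<noteq> 0" "\<And>j. m < e j \<Longrightarrow> x $ j = 0"
        "\<And>k. e k \<le> m \<Longrightarrow> (\<Sum>j\<in>UNIV. (deriv ^^ e k) (g j) t * x $ j) = 0"
        using padded_wronskian_singular[OF Suc.prems(5)[OF mem[OF t]]]
        by (auto simp: Suc_le_eq less_Suc_eq_le)
      \<comment> \<open>Otherwise \<open>x\<close> would lie in the kernel of the invertible smaller
        block. Hence the coordinate of the last column can be scaled to 1.\<close>
      have "x $ n \<noteq> 0"
      proof
        assume "x $ n = 0"
        then have supp: "x $ j = 0" if "m \<le> e j" for j
          using x(2)[of j] that n e_inj[of j n] by (cases "e j = m") auto
        have "padded_wronskian e g m t *v x = 0"
          by (simp add: vec_eq_iff padded_wronskian_mult_nth[OF supp] x(3))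
        then show False using inv[OF t] x(1)
          by (auto simp: invertible_left_inverse matrix_left_invertible_ker)
      qed
      then show ?thesis
        using x(2,3) by (intro exI[of _ "(1 / x $ n) *\<^sub>R x"])
          (auto simp: sum_distrib_left[symmetric] sum_divide_distrib[symmetric])
    qed
    then obtain \<alpha> where \<alpha>: "\<And>t. t \<in> {a'<..<b'} \<Longrightarrow> \<alpha> t $ n = 1"
      "\<And>t j. t \<in> {a'<..<b'} \<Longrightarrow> m < e j \<Longrightarrow> \<alpha> t $ j = 0"
      "\<And>t k. t \<in> {a'<..<b'} \<Longrightarrow> e k \<le> m \<Longrightarrow> (\<Sum>j\<in>UNIV. (deriv ^^ e k) (g j) t * \<alpha> t $ j) = 0"
      by metis

    \<comment> \<open>No regularity of \<open>\<alpha>\<close> is known beforehand. With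
      coefficients frozen at \<open>t\<close>, each row relation \<open>\<phi>\<close> of order
      below \<open>m\<close> vanishes at \<open>t\<close> together with its derivative, which is the
      next row; so it is o(s - t). Applying the smaller block at \<open>s\<close> to
      \<open>\<alpha> s - \<alpha> t\<close> gives minus these terms, and its lower bound transfers
      the rate.\<close>
    have "((\<lambda>t. \<alpha> t $ i) has_real_derivative 0) (at t)" if t: "t \<in> {a'<..<b'}" for t i
    proof (rule DERIV_0_if_smallo)
      obtain K where K: "K > 0" "\<forall>\<^sub>F s in at t. \<forall>x. norm x \<le> K * norm (padded_wronskian e g m s *v x)"
        using matrix_bounded_below[OF lim[OF mem[OF t]] inv[OF t]] by auto
      define \<phi> where "\<phi> k s = (\<Sum>j\<in>UNIV. (deriv ^^ k) (g j) s * \<alpha> t $ j)" for k s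
      have small: "\<phi> (e k) \<in> o[at t](\<lambda>s. s - t)" if k: "e k < m" for k
      proof -
        have "m < CARD('s)" using Suc.prems(3) by simp
        then have "Suc (e k) \<in> range e" using k e by (auto simp: bij_betw_def)
        then obtain l where l: "e l = Suc (e k)" by auto
        have "(\<phi> (e k) has_real_derivative (\<Sum>j\<in>UNIV. (deriv ^^ Suc (e k)) (g j) t * \<alpha> t $ j)) (at t)"
          unfolding \<phi>_def using Suc.prems(4) mem[OF t] k
          by (intro DERIV_sum DERIV_cmult_right)
             (auto simp: Ck_on_def DERIV_deriv_iff_real_differentiable)
        then have "(\<phi> (e k) has_real_derivative 0) (at t)"
          using \<alpha>(3)[OF t, of l] k l by simp
        moreover have "\<phi> (e k) t = 0" using \<alpha>(3)[OF t, of k] k by (simp add: \<phi>_def)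
        ultimately show ?thesis
          by (intro smalloI_tendsto) (auto simp: has_field_derivative_iff eventually_at_filter)
      qed
      have sum_small: "(\<lambda>s. \<Sum>k\<in>{k. e k < m}. \<bar>\<phi> (e k) s\<bar>) \<in> o[at t](\<lambda>s. s - t)"
        using small by (intro big_sum_in_smallo) auto
      have "eventually (\<lambda>s. norm (\<alpha> s $ i - \<alpha> t $ i) \<le> K * norm (\<Sum>k\<in>{k. e k < m}. \<bar>\<phi> (e k) s\<bar>)) (at t)"
        using K(2) eventually_at_in_open'[OF open_greaterThanLessThan t]
      proof eventually_elim
        case (elim s)
        define x where "x = \<alpha> s - \<alpha> t"
        \<comment> \<open>The normalisation cancels coordinate \<open>n\<close>, so the difference
          lies in the block where the matrix is bounded below.\<close>
        have supp: "x $ j = 0" if "m \<le> e j" for j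
        proof (cases "e j = m")
          case True
          then have "j = n" using n e_inj by simp
          then show ?thesis using \<alpha>(1) elim(2) t by (simp add: x_def)
        next
          case False
          then show ?thesis using \<alpha>(2) elim(2) t that by (simp add: x_def)
        qed
        have eq: "(padded_wronskian e g m s *v x) $ k = (if e k < m then - \<phi> (e k) s else 0)" for k
        proof -
          have "(\<Sum>j\<in>UNIV. (deriv ^^ e k) (g j) s * x $ j) = - \<phi> (e k) s" if "e k < m"
            using \<alpha>(3)[OF elim(2), of k] that
            by (simp add: x_def \<phi>_def right_diff_distrib sum_subtractf)
          then show ?thesis using supp by (simp add: padded_wronskian_mult_nth)
        qed
        have "norm (\<alpha> s $ i - \<alpha> t $ i) \<le> norm x"
          using component_le_norm_cart[of x i] by (simp add: x_def)
        also have "\<dots> \<le> K * norm (padded_wronskian e g m s *v x)" using elim(1) by blast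
        also have "\<dots> \<le> K * (\<Sum>k\<in>UNIV. \<bar>(padded_wronskian e g m s *v x) $ k\<bar>)"
          using K(1) by (intro mult_left_mono norm_le_l1_cart) auto
        also have "(\<Sum>k\<in>UNIV. \<bar>(padded_wronskian e g m s *v x) $ k\<bar>) = (\<Sum>k\<in>{k. e k < m}. \<bar>\<phi> (e k) s\<bar>)"
          unfolding eq by (intro sum.mono_neutral_cong_right) auto
        finally show ?case by (simp add: sum_nonneg)
      qed
      then have "(\<lambda>s. \<alpha> s $ i - \<alpha> t $ i) \<in> O[at t](\<lambda>s. \<Sum>k\<in>{k. e k < m}. \<bar>\<phi> (e k) s\<bar>)"
        by (rule bigoI)
      then show "(\<lambda>s. \<alpha> s $ i - \<alpha> t $ i) \<in> o[at t](\<lambda>s. s - t)"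
        using sum_small by (rule landau_o.big_small_trans)
    qed
    then have "\<exists>C. \<forall>t\<in>{a'<..<b'}. \<alpha> t $ i = C" for i
      by (intro has_field_derivative_zero_constant) (auto intro: has_field_derivative_at_within)
    then obtain C where C: "\<And>t i. t \<in> {a'<..<b'} \<Longrightarrow> \<alpha> t $ i = C i" by metis
    \<comment> \<open>The row of order zero is the linear relation between the functions
      themselves.\<close>
    have "0 \<in> range e" using e by (auto simp: bij_betw_def)
    then obtain l where l: "e l = 0" by auto
    have "(\<Sum>j\<in>UNIV. g j t * (\<chi> i. C i) $ j) = 0" if "t \<in> {a'<..<b'}" for t
      using \<alpha>(3)[OF that, of l] by (simp add: l C[OF that])
    moreover have "\<tau> \<in> {a'<..<b'}" using r(1) by (simp add: a'_def b'_def)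
    then have "C n = 1" using \<alpha>(1) C by metis
    then have "(\<chi> i. C i) \<noteq> 0" by (metis vec_lambda_beta zero_index zero_neq_one)
    ultimately show ?thesis using sub \<open>a' < b'\<close> by blast
  qed
qed

section \<open>Zeros of the Wronskian under the collocation condition\<close>

lemma Ck_on_subset: "Ck_on n D v \<Longrightarrow> S \<subseteq> D \<Longrightarrow> Ck_on n S v"
  by (auto simp: Ck_on_def intro: continuous_on_subset)

text \<open>Zeros of the continuous determinant form a closed subset of the compact interval, so
  taking the closure adds no point where it is nonzero. An interior point would then give a whole
  interval of zeros.\<close>

lemma wronskian_zeros_nowhere_dense:
  fixes u :: "'s::finite \<Rightarrow> real \<Rightarrow> real" and c :: "real ^ 's"
  assumes "open D" and "{t0..t0 + T} \<subseteq> D" and u: "\<And>i. Ck_on (CARD('s) + 2) D (u i)"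
    and collocation: "collocation_condition u c t0 T"
  shows "interior (closure {t\<in>{t0..<t0 + T}. \<not> wronskian_nonzero u t}) = {}"
proof (rule ccontr)
  obtain e where e: "bij_betw e (UNIV :: 's set) {..<CARD('s)}"
    using ex_bij_betw_finite_nat[of "UNIV :: 's set"] by (auto simp: atLeast0LessThan)
  define g where "g j = (deriv ^^ 2) (u j)" for j
  have g: "Ck_on (CARD('s)) D (g j)" for j
    using Ck_on_deriv[OF u, of 2 "CARD('s)"] by (simp add: g_def)
  define P where "P = padded_wronskian e g (CARD('s))"
  have P: "P t = (\<chi> k j. (deriv ^^ e k) (g j) t)" for t
    using e by (auto simp: P_def padded_wronskian_def vec_eq_iff bij_betw_def)
  let ?Z = "{t\<in>{t0..t0 + T}. det (P t) = 0}"
  have "isCont (\<lambda>t. det (P t)) t" if "t \<in> D" for t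
    unfolding isCont_def det_def P_def
    using padded_wronskian_tendsto[OF g \<open>open D\<close> that] by (intro tendsto_intros)
  then have "continuous_on {t0..t0 + T} (\<lambda>t. det (P t))"
    using assms(2) by (intro continuous_at_imp_continuous_on) auto
  then have "closed ?Z" by (rule continuous_closed_preimage_constant) simp
  moreover have "{t\<in>{t0..<t0 + T}. \<not> wronskian_nonzero u t} \<subseteq> ?Z"
    using e by (auto simp: wronskian_nonzero_def P g_def)
  ultimately have sub: "closure {t\<in>{t0..<t0 + T}. \<not> wronskian_nonzero u t} \<subseteq> ?Z"
    by (intro closure_minimal)
  assume "interior (closure {t\<in>{t0..<t0 + T}. \<not> wronskian_nonzero u t}) \<noteq> {}"
  then obtain \<tau> where "\<tau> \<in> interior (closure {t\<in>{t0..<t0 + T}. \<not> wronskian_nonzero u t})" by blast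
  then obtain \<epsilon> where "\<epsilon> > 0" and ball: "ball \<tau> \<epsilon> \<subseteq> ?Z"
    using sub by (auto simp: mem_interior)
  define a b where "a = \<tau> - \<epsilon>" and "b = \<tau> + \<epsilon>"
  have Z: "{a<..<b} \<subseteq> ?Z" using ball by (simp add: a_def b_def ball_eq_greaterThanLessThan)
  have "a < b" using \<open>\<epsilon> > 0\<close> by (simp add: a_def b_def)
  have singular: "\<not> invertible (padded_wronskian e g (CARD('s)) t)" if "t \<in> {a<..<b}" for t
    using Z that by (auto simp: invertible_det_nz P_def)
  have g_ab: "Ck_on (CARD('s)) {a<..<b} (g j)" for j
    by (rule Ck_on_subset[OF g]) (use Z assms(2) in blast)
  obtain a' b' x where ab: "a \<le> a'" "a' < b'" "b' \<le> b" and "x \<noteq> 0"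
    and dependent: "\<And>t. t \<in> {a'<..<b'} \<Longrightarrow> (\<Sum>j\<in>UNIV. g j t * x $ j) = 0"
    using wronskian_vanishing_imp_dependent[OF \<open>a < b\<close> e order_refl g_ab singular] by blast

  define t where "t = (a' + b') / 2"
  have t: "t \<in> {a'<..<b'}" using ab by (simp add: t_def)
  have between: "t0 \<le> s \<and> s \<le> t0 + T" if "s \<in> {a<..<b}" for s
    using subsetD[OF Z that] by simp
  \<comment> \<open>The collocation condition covers only the half-open interval; a point to the
    right of \<open>t\<close> that is still in range shows that \<open>t\<close> is not its right
    end.\<close>
  have "(t + b') / 2 \<in> {a<..<b}" "t \<in> {a<..<b}" using t ab by auto
  from between[OF this(1)] between[OF this(2)]
  have "(t + b') / 2 \<le> t0 + T" "t0 \<le> t" by simp_all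
  then have "t \<in> {t0..<t0 + T}" using t by auto
  then obtain hmax where "hmax > 0" and AE: "AE h in lebesgue_on {0..hmax}. invertible (F_matrix u c t h)"
    using collocation by (auto simp: collocation_condition_def)
  have "eventually (\<lambda>h. \<forall>i. t + c $ i * h \<in> {a'<..<b'}) (nhds 0)"
  proof (rule eventually_all_finite)
    fix i
    have "((\<lambda>h. t + c $ i * h) \<longlongrightarrow> t + c $ i * 0) (nhds 0)"
      by (intro tendsto_add tendsto_mult tendsto_const filterlim_ident)
    then show "eventually (\<lambda>h. t + c $ i * h \<in> {a'<..<b'}) (nhds 0)"
      using t by (intro topological_tendstoD) auto
  qed
  then obtain \<delta> where "\<delta> > 0" and \<delta>: "\<And>h i. \<bar>h\<bar> < \<delta> \<Longrightarrow> t + c $ i * h \<in> {a'<..<b'}"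
    by (auto simp: eventually_nhds_metric dist_real_def)
  have F_singular: "\<not> invertible (F_matrix u c t h)" if "\<bar>h\<bar> < \<delta>" for h
  proof -
    have "F_matrix u c t h *v x = 0"
      using dependent[OF \<delta>[OF that]]
      by (simp add: vec_eq_iff F_matrix_def at_nodes_def matrix_vector_mult_def g_def)
    then show ?thesis
      using \<open>x \<noteq> 0\<close> by (auto simp: invertible_left_inverse matrix_left_invertible_ker)
  qed
  \<comment> \<open>On this nonempty open set of step sizes the matrix is singular, yet the
    collocation condition would make the set negligible.\<close>
  let ?S = "{0<..<min \<delta> hmax}"
  have "AE h in lebesgue. h \<in> {0..hmax} \<longrightarrow> invertible (F_matrix u c t h)"
    using AE by (simp add: AE_restrict_space_iff)
  then have "AE h in lebesgue. h \<notin> ?S"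
    by eventually_elim (use F_singular in auto)
  then have "?S \<in> null_sets lebesgue" by (subst AE_iff_null_sets) auto
  then have "negligible ?S" by (simp add: negligible_iff_null_sets)
  moreover have "min \<delta> hmax / 2 \<in> ?S" using \<open>\<delta> > 0\<close> \<open>hmax > 0\<close> by (auto simp: min_def)
  then have "?S \<noteq> {}" by blast
  ultimately show False using open_not_negligible[of ?S] by simp
qed

text \<open>The order is asserted where the Wronskian is nonzero, since it can drop at zeros
  permitted by the collocation condition; the second conjunct bounds how large that exceptional set
  can be.\<close>

theorem theorem4p3:
  fixes u :: "'s::finite \<Rightarrow> real \<Rightarrow> real"
    and c :: "real ^ 's"
    and A :: "real \<Rightarrow> real \<Rightarrow> real ^ 's ^ 's"
    and b d :: "real \<Rightarrow> real \<Rightarrow> real ^ 's"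
    and f :: "real \<Rightarrow> real \<Rightarrow> real"
    and y :: "real \<Rightarrow> real"
    and t0 T y0 y0' :: real
    and D :: "real set"
  assumes "T > 0" and "open D" and "{t0..t0 + T} \<subseteq> D"
    and f_continuous: "\<And>x. continuous_on D (\<lambda>t. f t x)"
    and f_lipschitz: "\<exists>L. \<forall>t\<in>D. L-lipschitz_on UNIV (f t)"
    and y_solution: "solves_ivp D f t0 y0 y0' y"
    and y_smooth: "Ck_on (CARD('s) + 4) D y"
    and u_smooth: "\<And>i. Ck_on (CARD('s) + 4) D (u i)"
    and c_distinct: "inj (\<lambda>i. c $ i)"
    and collocation: "collocation_condition u c t0 T"
    and coefficients: "\<And>t h. t \<in> {t0..<t0 + T} \<Longrightarrow> h > 0 \<Longrightarrow> invertible (F_matrix u c t h) \<Longrightarrow>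
           fitted u c t h (A t h) (b t h) (d t h)"
    and orthogonality: "\<And>k. k \<in> {0, 1} \<Longrightarrow>
           integral {0..1} (\<lambda>\<xi>. \<xi> ^ (k::nat) * (\<Prod>i\<in>UNIV. \<xi> - c $ i)) = 0"
  shows "(\<forall>t\<in>{t0..<t0 + T}. wronskian_nonzero u t \<longrightarrow>
            has_step_order u c A b d f y t (CARD('s) + 2)) \<and>
         interior (closure {t\<in>{t0..<t0 + T}. \<not> wronskian_nonzero u t}) = {}"
proof (intro conjI ballI impI)
  fix t
  assume t: "t \<in> {t0..<t0 + T}" and wronskian: "wronskian_nonzero u t"
  obtain L where L: "\<And>x. x \<in> D \<Longrightarrow> L-lipschitz_on UNIV (f x)"
    using f_lipschitz by blast
  have ode: "(deriv ^^ 2) y x = f x (y x)" if "x \<in> D" for x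
    using y_solution that unfolding solves_ivp_def by blast
  have "t \<in> D" using t \<open>{t0..t0 + T} \<subseteq> D\<close> by auto
  from feptrkn_step_order[where f = f and A = A and b = b and d = d, OF \<open>open D\<close> this L ode y_smooth u_smooth c_distinct
      coefficients[OF t] orthogonality wronskian]
  show "has_step_order u c A b d f y t (CARD('s) + 2)" .
next
  have "Ck_on (CARD('s) + 2) D (u i)" for i
    using Ck_on_deriv[OF u_smooth, of 0 "CARD('s) + 2"] by simp
  from wronskian_zeros_nowhere_dense[OF \<open>open D\<close> \<open>{t0..t0 + T} \<subseteq> D\<close> this collocation]
  show "interior (closure {t\<in>{t0..<t0 + T}. \<not> wronskian_nonzero u t}) = {}" .
qed

end
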